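(* Let $X$ be a complex projective manifold of dimension $n$, $L$ a big holomorphic line bundle on $X$, and $\psi$ a continuous metric on $L$. For any point $p\in\Delta(L)^{\circ}$ (the interior of the Okounkov body of $L$) and any sequence $\alpha(k)\in\frac1k v(H^0(kL))$, $k\to\infty$, converging to $p$, the limit $$\lim_{k\to\infty}\frac1k F[\psi](k\alpha(k),k)$$ exists and depends only on $p$ (not on the choice of the sequence). (One may therefore define the Chebyshev transform $c[\psi]$ on $\Delta(L)^\circ$ by letting $c[\psi](p)$ be this limit.)
   Context: $X$ is a (connected) complex projective manifold of dimension $n$. Tensor powers are written additively: $kL=L^{\otimes k}$. $L$ is big if $\mathrm{vol}(L):=\limsup_{k\to\infty}\frac{n!}{k^n}\dim H^0(kL)>0$. A continuous hermitian metric $h=e^{-\psi}$ on $L$ is denoted by $\psi$: for a local frame $f$ one has $|f|_h^2=e^{-\psi_f}$ with $\psi_f$ continuous; $k\psi$ is the induced metric on $kL$, and for $s\in H^0(kL)$, $|s|^2e^{-k\psi}$ denotes the pointwise squared norm. Put $\|s\|_{k\psi}^2:=\sup_{x\in X}\{|s(x)|^2e^{-k\psi(x)}\}$. Fix a point $x_0\in X$, local holomorphic coordinates $z_1,\dots,z_n$ centered at $x_0$, and a local trivialization $e$ of $L$ near $x_0$. A nonzero $s\in H^0(kL)$ has a power series expansion $s/e^k=\sum_\alpha a_\alpha z^\alpha$, written simply $s=\sum_\alpha a_\alpha z^\alpha$; $v(s)\in\mathbb{N}^n$ is the lexicographically smallest $\alpha$ with $a_\alpha\neq0$, and $v(H^0(kL)):=\{v(s):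 s\in H^0(kL), s\ne 0\}$. The Okounkov body $\Delta(L)\subset\mathbb{R}^n$ is the closed convex hull of $\bigcup_{k\ge1}\frac1k v(H^0(kL))$. For $\alpha\in\frac1k v(H^0(kL))$, $A_{\alpha,k}$ is the affine space of sections in $H^0(kL)$ of the form $z^{k\alpha}+$ higher order terms (with respect to the lexicographic order), and $F[\psi](k\alpha,k):=\inf\{\ln\|s\|_{k\psi}^2: s\in A_{\alpha,k}\}$. *)

theory Defs
  imports
    "HOL-Analysis.Analysis"
    "HOL-Library.Function_Algebras"
    "HOL-Library.Fun_Lexorder"
begin

section \<open>Holomorphic functions of several variables\<close>

definition holomorphic_cn :: "(complex ^ 'n \<Rightarrow> complex) \<Rightarrow> (complex ^ 'n) set \<Rightarrow> bool" where
  "holomorphic_cn f S \<longleftrightarrow>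
     (\<forall>z\<in>S. \<exists>D. (f has_derivative D) (at z) \<and> (\<forall>c v. D (c *s v) = c * D v))"


section \<open>Complex projective manifolds\<close>

text \<open>A space with an atlas: the second field is a set of charts, given as pairs of a domain
  and a coordinate map into \<open>\<complex>\<^sup>n\<close>, where \<open>n = CARD('n)\<close>.\<close>

record ('x, 'n::finite) cspace =
  points :: "'x set"
  charts :: "('x set \<times> ('x \<Rightarrow> complex ^ 'n)) set"

definition is_chart :: "'x::t2_space set \<Rightarrow> 'x set \<Rightarrow> ('x \<Rightarrow> complex ^ 'n) \<Rightarrow> bool" where
  "is_chart P U \<phi> \<longleftrightarrow> openin (top_of_set P) U \<and> open (\<phi> ` U) \<and> (\<exists>g. homeomorphism U (\<phi> ` U) \<phi> g)"

definition holomorphic_transition ::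
  "'x set \<Rightarrow> ('x \<Rightarrow> complex ^ 'n) \<Rightarrow> 'x set \<Rightarrow> ('x \<Rightarrow> complex ^ 'n) \<Rightarrow> bool" where
  "holomorphic_transition U \<phi> V \<eta> \<longleftrightarrow>
     (\<forall>j. holomorphic_cn (\<lambda>z. \<eta> (inv_into U \<phi> z) $ j) (\<phi> ` (U \<inter> V)))"

definition compact_complex_manifold :: "('x::t2_space, 'n::finite) cspace \<Rightarrow> bool" where
  "compact_complex_manifold X \<longleftrightarrow>
     compact (points X) \<and> connected (points X) \<and>
     (\<forall>(U, \<phi>)\<in>charts X. is_chart (points X) U \<phi>) \<and>
     \<Union> (fst ` charts X) = points X \<and>
     (\<forall>(U, \<phi>)\<in>charts X. \<forall>(V, \<eta>)\<in>charts X. holomorphic_transition U \<phi> V \<eta>)"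

text \<open>Holomorphy of a function on a (relatively open) subset \<open>S\<close> of \<open>X\<close>.\<close>

definition holomorphic_fun ::
  "('x::t2_space, 'n::finite) cspace \<Rightarrow> ('x \<Rightarrow> complex) \<Rightarrow> 'x set \<Rightarrow> bool" where
  "holomorphic_fun X f S \<longleftrightarrow>
     (\<forall>(U, \<phi>)\<in>charts X. holomorphic_cn (\<lambda>z. f (inv_into U \<phi> z)) (\<phi> ` (S \<inter> U)))"

text \<open>\<open>\<Phi>\<close> is an injective holomorphic immersion of \<open>X\<close> into projective \<open>N\<close>-space;
  on a compact manifold this is the same as a holomorphic embedding.  \<open>\<Phi> x\<close> is any choice of
  homogeneous coordinates \<open>(\<Phi> x 0, \<dots>, \<Phi> x N)\<close> of the image of \<open>x\<close>, so that only ratios carry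
  meaning; the last two conditions are read in the standard affine charts
  \<open>[Z\<^sub>0 : \<dots> : Z\<^sub>N] \<mapsto> (Z\<^sub>i / Z\<^sub>j)\<^sub>i\<close> of the target.\<close>

definition projective_embedding ::
  "('x::t2_space, 'n::finite) cspace \<Rightarrow> nat \<Rightarrow> ('x \<Rightarrow> nat \<Rightarrow> complex) \<Rightarrow> bool" where
  "projective_embedding X N \<Phi> \<longleftrightarrow>
     (\<forall>x\<in>points X. \<exists>j\<le>N. \<Phi> x j \<noteq> 0) \<and>
     (\<forall>x\<in>points X. \<forall>y\<in>points X. (\<exists>c. c \<noteq> 0 \<and> (\<forall>j\<le>N. \<Phi> x j = c * \<Phi> y j)) \<longrightarrow> x = y) \<and>
     (\<forall>j\<le>N. let S = {x \<in> points X. \<Phi> x j \<noteq> 0} in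
        openin (top_of_set (points X)) S \<and>
        (\<forall>i\<le>N. holomorphic_fun X (\<lambda>x. \<Phi> x i / \<Phi> x j) S) \<and>
        (\<forall>(U, \<phi>)\<in>charts X. \<forall>z \<in> \<phi> ` (S \<inter> U). \<forall>v. v \<noteq> 0 \<longrightarrow>
           (\<exists>i\<le>N. frechet_derivative
              (\<lambda>z. \<Phi> (inv_into U \<phi> z) i / \<Phi> (inv_into U \<phi> z) j) (at z) v \<noteq> 0)))"

definition projective_manifold :: "('x::t2_space, 'n::finite) cspace \<Rightarrow> bool" where
  "projective_manifold X \<longleftrightarrow>
     compact_complex_manifold X \<and> (\<exists>N \<Phi>. projective_embedding X N \<Phi>)"


section \<open>Line bundles, sections and metrics\<close>

text \<open>A line bundle is given by a trivializing cover \<open>triv_dom i\<close> (\<open>i \<in> indices\<close>) with frames \<open>f\<^sub>i\<close>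
  and transition functions \<open>transition i j\<close>, where a section \<open>s = s\<^sub>i f\<^sub>i\<close> satisfies
  \<open>s\<^sub>i = transition i j * s\<^sub>j\<close> on overlaps.\<close>

record ('x, 'i) lbundle =
  indices :: "'i set"
  triv_dom :: "'i \<Rightarrow> 'x set"
  transition :: "'i \<Rightarrow> 'i \<Rightarrow> 'x \<Rightarrow> complex"

definition line_bundle :: "('x::t2_space, 'n::finite) cspace \<Rightarrow> ('x, 'i) lbundle \<Rightarrow> bool" where
  "line_bundle X L \<longleftrightarrow>
     (\<forall>i\<in>indices L. openin (top_of_set (points X)) (triv_dom L i)) \<and>
     (\<Union>i\<in>indices L. triv_dom L i) = points X \<and>
     (\<forall>i\<in>indices L. \<forall>j\<in>indices L.
        holomorphic_fun X (transition L i j) (triv_dom L i \<inter> triv_dom L j) \<and>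
        (\<forall>x\<in>triv_dom L i \<inter> triv_dom L j. transition L i j x \<noteq> 0)) \<and>
     (\<forall>i\<in>indices L. \<forall>j\<in>indices L. \<forall>l\<in>indices L.
      \<forall>x\<in>triv_dom L i \<inter> triv_dom L j \<inter> triv_dom L l.
        transition L i j x * transition L j l x = transition L i l x)"

text \<open>The tensor power \<open>kL\<close> has the transition functions \<open>(transition i j)\<^sup>k\<close>.  Sections are families
  \<open>(s\<^sub>i)\<close> of local functions, normalised to \<open>0\<close> outside their domains so that equality of
  sections is equality of families.\<close>

definition H0 ::
  "('x::t2_space, 'n::finite) cspace \<Rightarrow> ('x, 'i) lbundle \<Rightarrow> nat \<Rightarrow> ('i \<Rightarrow> 'x \<Rightarrow> complex) set" where
  "H0 X L k = {s.
     (\<forall>i\<in>indices L. holomorphic_fun X (s i) (triv_dom L i)) \<and>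
     (\<forall>i\<in>indices L. \<forall>j\<in>indices L. \<forall>x\<in>triv_dom L i \<inter> triv_dom L j.
        s i x = transition L i j x ^ k * s j x) \<and>
     (\<forall>i x. \<not> (i \<in> indices L \<and> x \<in> triv_dom L i) \<longrightarrow> s i x = 0)}"

definition section_scale :: "complex \<Rightarrow> ('i \<Rightarrow> 'x \<Rightarrow> complex) \<Rightarrow> ('i \<Rightarrow> 'x \<Rightarrow> complex)" where
  "section_scale c s = (\<lambda>i x. c * s i x)"

lemma vector_space_section_scale: "vector_space section_scale"
  by unfold_locales (auto simp: section_scale_def fun_eq_iff algebra_simps)

definition h0 :: "('x::t2_space, 'n::finite) cspace \<Rightarrow> ('x, 'i) lbundle \<Rightarrow> nat \<Rightarrow> nat" where
  "h0 X L k = vector_space.dim section_scale (H0 X L k)"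

definition volume :: "('x::t2_space, 'n::finite) cspace \<Rightarrow> ('x, 'i) lbundle \<Rightarrow> ereal" where
  "volume X L = limsup (\<lambda>k. ereal (fact CARD('n) / real k ^ CARD('n) * real (h0 X L k)))"

definition big :: "('x::t2_space, 'n::finite) cspace \<Rightarrow> ('x, 'i) lbundle \<Rightarrow> bool" where
  "big X L \<longleftrightarrow> volume X L > 0"

text \<open>A metric \<open>h = e\<^sup>-\<^sup>\<psi>\<close> is given by \<open>\<psi> i = - ln |f\<^sub>i|\<^sub>h\<^sup>2\<close>, so that \<open>|s|\<^sub>h\<^sup>2 = |s\<^sub>i|\<^sup>2 e\<^sup>-\<^sup>\<psi>\<^sup>i\<close>; since
  \<open>f\<^sub>j = transition i j * f\<^sub>i\<close>, this forces the transformation rule below.\<close>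

definition continuous_metric :: "('x::t2_space, 'i) lbundle \<Rightarrow> ('i \<Rightarrow> 'x \<Rightarrow> real) \<Rightarrow> bool" where
  "continuous_metric L \<psi> \<longleftrightarrow>
     (\<forall>i\<in>indices L. continuous_on (triv_dom L i) (\<psi> i)) \<and>
     (\<forall>i\<in>indices L. \<forall>j\<in>indices L. \<forall>x\<in>triv_dom L i \<inter> triv_dom L j.
        \<psi> i x = \<psi> j x + ln ((cmod (transition L i j x))\<^sup>2))"

text \<open>\<open>\<parallel>s\<parallel>\<^sup>2\<close> with respect to \<open>k\<psi>\<close>.  The pointwise norm at \<open>x\<close> does not depend on the
  trivialization \<open>i\<close> around \<open>x\<close>, so the supremum over all pairs is the supremum over \<open>x\<close>.\<close>

definition sup_norm2 ::
  "('x, 'i) lbundle \<Rightarrow> ('i \<Rightarrow> 'x \<Rightarrow> real) \<Rightarrow> nat \<Rightarrow> ('i \<Rightarrow> 'x \<Rightarrow> complex) \<Rightarrow> real" where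
  "sup_norm2 L \<psi> k s =
     Sup {(cmod (s i x))\<^sup>2 * exp (- (real k * \<psi> i x)) | i x. i \<in> indices L \<and> x \<in> triv_dom L i}"


section \<open>Local expansions and the Okounkov body\<close>

record ('x, 'n::finite, 'i) local_data =
  nbhd :: "'x set"
  coord :: "'x \<Rightarrow> complex ^ 'n"
  frame :: "'i \<Rightarrow> 'x \<Rightarrow> complex"

text \<open>Holomorphic coordinates centered at \<open>x0\<close> and a trivialization of \<open>L\<close>, i.e. a nowhere
  vanishing holomorphic section, both on the neighbourhood \<open>nbhd E\<close> of \<open>x0\<close>.\<close>

definition local_data_at ::
  "('x::t2_space, 'n::finite) cspace \<Rightarrow> ('x, 'i) lbundle \<Rightarrow> 'x \<Rightarrow> ('x, 'n, 'i) local_data \<Rightarrow> bool"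
  where
  "local_data_at X L x0 E \<longleftrightarrow>
     x0 \<in> nbhd E \<and> is_chart (points X) (nbhd E) (coord E) \<and> coord E x0 = 0 \<and>
     (\<forall>(U, \<phi>)\<in>charts X. holomorphic_transition U \<phi> (nbhd E) (coord E) \<and>
                        holomorphic_transition (nbhd E) (coord E) U \<phi>) \<and>
     (\<forall>i\<in>indices L. holomorphic_fun X (frame E i) (nbhd E \<inter> triv_dom L i) \<and>
                    (\<forall>x\<in>nbhd E \<inter> triv_dom L i. frame E i x \<noteq> 0)) \<and>
     (\<forall>i\<in>indices L. \<forall>j\<in>indices L. \<forall>x\<in>nbhd E \<inter> triv_dom L i \<inter> triv_dom L j.
        frame E i x = transition L i j x * frame E j x)"

definition monomial :: "complex ^ 'n \<Rightarrow> nat ^ 'n \<Rightarrow> complex" where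
  "monomial z \<alpha> = (\<Prod>l\<in>UNIV. (z $ l) ^ (\<alpha> $ l))"

text \<open>\<open>s / e\<^sup>k = \<Sum>\<^sub>\<alpha> a\<^sub>\<alpha> z\<^sup>\<alpha>\<close> on some polydisc around the origin.\<close>

definition has_expansion ::
  "('x, 'i) lbundle \<Rightarrow> ('x, 'n::finite, 'i) local_data \<Rightarrow> nat \<Rightarrow> ('i \<Rightarrow> 'x \<Rightarrow> complex)
     \<Rightarrow> (nat ^ 'n \<Rightarrow> complex) \<Rightarrow> bool" where
  "has_expansion L E k s a \<longleftrightarrow>
     (\<exists>r>0. \<forall>x\<in>nbhd E. (\<forall>l. cmod (coord E x $ l) < r) \<longrightarrow>
        (\<forall>i\<in>indices L. x \<in> triv_dom L i \<longrightarrow>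
           ((\<lambda>\<alpha>. a \<alpha> * monomial (coord E x) \<alpha>) has_sum (s i x / frame E i x ^ k)) UNIV))"

definition lex_less :: "nat ^ 'n::{finite,linorder} \<Rightarrow> nat ^ 'n::{finite,linorder} \<Rightarrow> bool" where
  "lex_less \<beta> \<alpha> \<longleftrightarrow> less_fun (\<lambda>l. \<beta> $ l) (\<lambda>l. \<alpha> $ l)"

text \<open>\<open>s = c z\<^sup>\<alpha> + higher order terms\<close>.\<close>

definition has_lowest_term ::
  "('x, 'i) lbundle \<Rightarrow> ('x, 'n::{finite,linorder}, 'i) local_data \<Rightarrow> nat
     \<Rightarrow> ('i \<Rightarrow> 'x \<Rightarrow> complex) \<Rightarrow> complex \<Rightarrow> nat ^ 'n::{finite,linorder} \<Rightarrow> bool" where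
  "has_lowest_term L E k s c \<alpha> \<longleftrightarrow>
     (\<exists>a. has_expansion L E k s a \<and> a \<alpha> = c \<and> (\<forall>\<beta>. lex_less \<beta> \<alpha> \<longrightarrow> a \<beta> = 0))"

text \<open>\<open>v (s) = \<alpha>\<close>, as a relation; on a connected manifold every nonzero section of \<open>kL\<close> has
  exactly one such \<open>\<alpha>\<close>.  The lexicographic order compares smaller indices first.\<close>

definition has_valuation ::
  "('x, 'i) lbundle \<Rightarrow> ('x, 'n::{finite,linorder}, 'i) local_data \<Rightarrow> nat
     \<Rightarrow> ('i \<Rightarrow> 'x \<Rightarrow> complex) \<Rightarrow> nat ^ 'n::{finite,linorder} \<Rightarrow> bool" where
  "has_valuation L E k s \<alpha> \<longleftrightarrow> (\<exists>c. c \<noteq> 0 \<and> has_lowest_term L E k s c \<alpha>)"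

definition valuation_set ::
  "('x::t2_space, 'n::{finite,linorder}) cspace \<Rightarrow> ('x, 'i) lbundle \<Rightarrow> ('x, 'n, 'i) local_data
     \<Rightarrow> nat \<Rightarrow> (nat ^ 'n::{finite,linorder}) set" where
  "valuation_set X L E k = {\<alpha>. \<exists>s\<in>H0 X L k. s \<noteq> 0 \<and> has_valuation L E k s \<alpha>}"

definition real_vec :: "nat ^ 'n \<Rightarrow> real ^ 'n" where
  "real_vec \<alpha> = (\<chi> l. real (\<alpha> $ l))"

text \<open>\<open>1/k v(H\<^sup>0(kL))\<close>\<close>

definition scaled_valuation_set ::
  "('x::t2_space, 'n::{finite,linorder}) cspace \<Rightarrow> ('x, 'i) lbundle \<Rightarrow> ('x, 'n, 'i) local_data
     \<Rightarrow> nat \<Rightarrow> (real ^ 'n::{finite,linorder}) set" where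
  "scaled_valuation_set X L E k = (\<lambda>\<alpha>. (1 / real k) *\<^sub>R real_vec \<alpha>) ` valuation_set X L E k"

definition okounkov_body ::
  "('x::t2_space, 'n::{finite,linorder}) cspace \<Rightarrow> ('x, 'i) lbundle \<Rightarrow> ('x, 'n, 'i) local_data
     \<Rightarrow> (real ^ 'n::{finite,linorder}) set" where
  "okounkov_body X L E = closure (convex hull (\<Union>k\<in>{1..}. scaled_valuation_set X L E k))"


section \<open>The functional \<open>F[\<psi>]\<close>\<close>

text \<open>The affine space \<open>A\<^sub>\<alpha>\<^sub>,\<^sub>k\<close> for real \<open>\<alpha>\<close>; it is empty unless \<open>k\<alpha>\<close> is a multi-index.\<close>

definition A_space ::
  "('x::t2_space, 'n::{finite,linorder}) cspace \<Rightarrow> ('x, 'i) lbundle \<Rightarrow> ('x, 'n, 'i) local_data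
     \<Rightarrow> real ^ 'n::{finite,linorder} \<Rightarrow> nat \<Rightarrow> ('i \<Rightarrow> 'x \<Rightarrow> complex) set" where
  "A_space X L E \<alpha> k =
     {s \<in> H0 X L k. \<exists>m. real_vec m = real k *\<^sub>R \<alpha> \<and> has_lowest_term L E k s 1 m}"

text \<open>\<open>F[\<psi>](b, k)\<close>, where \<open>b = k\<alpha>\<close>.\<close>

definition F_functional ::
  "('x::t2_space, 'n::{finite,linorder}) cspace \<Rightarrow> ('x, 'i) lbundle \<Rightarrow> ('x, 'n, 'i) local_data
     \<Rightarrow> ('i \<Rightarrow> 'x \<Rightarrow> real) \<Rightarrow> real ^ 'n::{finite,linorder} \<Rightarrow> nat \<Rightarrow> real" where
  "F_functional X L E \<psi> b k = (INF s\<in>A_space X L E ((1 / real k) *\<^sub>R b) k. ln (sup_norm2 L \<psi> k s))"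

end

theory Submission
  imports Defs "HOL-Complex_Analysis.Conformal_Mappings"
begin

text \<open>
  Lowest terms of sections multiply, so the pairs \<open>(v(s), k)\<close> with \<open>s \<in> H\<^sup>0(kL)\<close>, \<open>k \<ge> 1\<close>, form a
  semigroup \<open>\<Gamma>\<close> of integral vectors.  If \<open>s\<close> and \<open>t\<close> compete in the infima that define \<open>F[\<psi>]\<close> at two
  points of \<open>\<Gamma>\<close>, then \<open>s t\<close> competes at their sum, and sup norms are submultiplicative: hence \<open>F[\<psi>]\<close>
  is subadditive on \<open>\<Gamma>\<close>.  The theorem is a Fekete lemma for \<open>F[\<psi>]\<close> on \<open>\<Gamma>\<close>
  (\<open>normalized_limit_exists\<close>), in which the slopes \<open>v(s)/k\<close> converge to an interior point \<open>p\<close> of the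
  closed convex hull of all slopes.

  The Fekete lemma rests on writing an element \<open>b\<close> of \<open>\<Gamma>\<close> with slope near \<open>p\<close> and large level \<open>k\<close> as
  \<open>q a + v\<close>, where \<open>a\<close> is a fixed element of \<open>\<Gamma>\<close> with slope near \<open>p\<close> and \<open>q a\<close> has level about
  \<open>(1 - \<epsilon>) k\<close>.  The remainder \<open>v\<close> lies in the group generated by \<open>\<Gamma>\<close>, has level about \<open>\<epsilon> k\<close>, and lies
  deep inside a cone spanned by finitely many elements of \<open>\<Gamma>\<close>, because \<open>p\<close> is interior.  Such
  elements belong to \<open>\<Gamma>\<close> themselves and \<open>F\<close> is bounded on them by a multiple of the level
  (\<open>deep_points_bounded\<close>).  So \<open>F(b)/k\<close> exceeds \<open>F(a)/snd a\<close> by at most \<open>O(\<epsilon>)\<close>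
  (\<open>near_comparison\<close>); with two arbitrary sequences in the roles of \<open>a\<close> and \<open>b\<close> this says that all
  upper and lower limits agree.

  For the limit to be finite, and the infima to be infima of sets bounded below, \<open>F\<close> needs a linear lower
  bound (\<open>ln_sup_norm2_lower_bound\<close>).  It is a Cauchy estimate for the lexicographically lowest
  coefficient of a holomorphic function on a polydisc (\<open>lex_lowest_coefficient_bound\<close>).  Restricting
  the function to the curve \<open>t \<mapsto> (r t\<^sup>w\<^sup>1, \<dots>, r t\<^sup>w\<^sup>n)\<close>, whose weights decrease so fast that the
  lexicographically lowest monomial becomes the unique one of lowest order in \<open>t\<close>, turns it into the
  Schwarz lemma in one variable.
\<close>

section \<open>Subadditive functions on semigroups of integral vectors\<close>

lemma finite_bounded_integral_vectors:
  fixes R :: real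
  shows "finite {v::'a::euclidean_space. (\<forall>b\<in>Basis. v \<bullet> b \<in> \<int>) \<and> norm v \<le> R}"
proof -
  let ?V = "{v::'a. (\<forall>b\<in>Basis. v \<bullet> b \<in> \<int>) \<and> norm v \<le> R}"
  let ?c = "\<lambda>v::'a. \<lambda>b\<in>Basis. v \<bullet> b"
  have "?c ` ?V \<subseteq> (Basis \<rightarrow>\<^sub>E {t \<in> \<int>. \<bar>t\<bar> \<le> R})"
    using Basis_le_norm order_trans by (fastforce simp: PiE_iff)
  moreover have "finite (Basis \<rightarrow>\<^sub>E {t::real. t \<in> \<int> \<and> \<bar>t\<bar> \<le> R} :: ('a \<Rightarrow> real) set)"
    by (intro finite_PiE finite_abs_int_segment) auto
  moreover have "inj_on ?c ?V"
    by (rule inj_onI, rule euclidean_eqI) (metis restrict_apply')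
  ultimately show ?thesis
    by (meson finite_imageD finite_subset)
qed

text \<open>A small cube around \<open>p\<close> lies in the hull of \<open>S\<close>; each of its finitely many corners is a convex
  combination of finitely many points of \<open>S\<close>, and these points together have the whole cube in their
  hull.\<close>

lemma interior_convex_hull_finite_subset:
  fixes S :: "'a::euclidean_space set"
  assumes "p \<in> interior (closure (convex hull S))"
  obtains T \<rho> where "finite T" "T \<subseteq> S" "0 < \<rho>" "ball p \<rho> \<subseteq> convex hull T"
proof -
  have "p \<in> interior (convex hull S)"
    using assms by (simp add: convex_interior_closure)
  then obtain e where e: "e > 0" "ball p e \<subseteq> convex hull S"
    by (meson mem_interior)
  \<comment> \<open>The half width is chosen such that the cube fits into the ball of radius \<open>e\<close> in the 1-norm.\<close>
  define d where "d = e / (2 * DIM('a))"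
  define D :: 'a where "D = (\<Sum>i\<in>Basis. d *\<^sub>R i)"
  have d: "d > 0" using e by (simp add: d_def)
  obtain C :: "'a set" where C: "finite C" "cbox (p - D) (p + D) = convex hull C"
    unfolding D_def using cube_convex_hull[OF d] by blast
  have Db: "D \<bullet> b = d" if "b \<in> Basis" for b
    using that by (simp add: D_def inner_sum_left inner_Basis if_distrib cong: if_cong)
  have cube_le: "norm (x - p) < e" if "x \<in> cbox (p - D) (p + D)" for x
  proof -
    have "norm (x - p) \<le> (\<Sum>b\<in>Basis. \<bar>(x - p) \<bullet> b\<bar>)" by (rule norm_le_l1)
    also have "\<dots> \<le> (\<Sum>b\<in>(Basis::'a set). d)"
    proof (rule sum_mono)
      fix b :: 'a assume b: "b \<in> Basis"
      have "p \<bullet> b - d \<le> x \<bullet> b" "x \<bullet> b \<le> p \<bullet> b + d"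
        using that b Db[OF b] unfolding mem_box by (auto simp: inner_diff_left inner_add_left)
      then show "\<bar>(x - p) \<bullet> b\<bar> \<le> d"
        by (simp add: inner_diff_left abs_le_iff)
    qed
    also have "\<dots> < e" using e by (simp add: d_def)
    finally show ?thesis .
  qed
  have "C \<subseteq> convex hull S"
  proof
    fix x assume "x \<in> C"
    then have "x \<in> cbox (p - D) (p + D)" using C by (simp add: hull_inc)
    from cube_le[OF this] show "x \<in> convex hull S"
      using e(2) by (auto simp: dist_norm norm_minus_commute)
  qed
  then have "\<forall>x\<in>C. \<exists>U. finite U \<and> U \<subseteq> S \<and> x \<in> convex hull U"
    by (subst (asm) caratheodory_aff_dim) auto
  then obtain U where U: "\<And>x. x \<in> C \<Longrightarrow> finite (U x) \<and> U x \<subseteq> S \<and> x \<in> convex hull (U x)"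
    by metis
  let ?T = "\<Union>x\<in>C. U x"
  have "C \<subseteq> convex hull ?T"
  proof
    fix x assume x: "x \<in> C"
    then have "convex hull (U x) \<subseteq> convex hull ?T" by (intro hull_mono) auto
    then show "x \<in> convex hull ?T" using U[OF x] by blast
  qed
  then have sub: "convex hull C \<subseteq> convex hull ?T" by (simp add: hull_minimal)
  have "ball p d \<subseteq> cbox (p - D) (p + D)"
  proof
    fix x assume "x \<in> ball p d"
    then have "norm (x - p) < d" by (simp add: dist_norm norm_minus_commute)
    then have le: "\<bar>(x - p) \<bullet> b\<bar> \<le> d" if "b \<in> Basis" for b
      using Basis_le_norm[OF that, of "x - p"] by linarith
    show "x \<in> cbox (p - D) (p + D)" unfolding mem_box
    proof
      fix b :: 'a assume b: "b \<in> Basis"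
      show "(p - D) \<bullet> b \<le> x \<bullet> b \<and> x \<bullet> b \<le> (p + D) \<bullet> b"
        using le[OF b] Db[OF b] by (simp add: inner_diff_left inner_add_left abs_le_iff)
    qed
  qed
  then have "ball p d \<subseteq> convex hull ?T" using C sub by simp
  then show ?thesis
    using that[of ?T d] C(1) U d by blast
qed

text \<open>An element \<open>(x, k)\<close> of the semigroup has level \<open>k\<close> and slope \<open>x / k\<close>.  Integrality is what makes bounded
  sets of remainders finite.\<close>

locale subadditive_semigroup =
  fixes \<Gamma> :: "('a::euclidean_space \<times> real) set" and F :: "'a \<times> real \<Rightarrow> real"
  assumes add_closed: "u \<in> \<Gamma> \<Longrightarrow> v \<in> \<Gamma> \<Longrightarrow> u + v \<in> \<Gamma>"
    and subadditive: "u \<in> \<Gamma> \<Longrightarrow> v \<in> \<Gamma> \<Longrightarrow> F (u + v) \<le> F u + F v"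
    and integral: "u \<in> \<Gamma> \<Longrightarrow> b \<in> Basis \<Longrightarrow> u \<bullet> b \<in> \<int>"
    and level_ge_1: "u \<in> \<Gamma> \<Longrightarrow> 1 \<le> snd u"
begin

definition "difference_group = {u - v | u v. u \<in> \<Gamma> \<and> v \<in> \<Gamma>}"

lemma difference_groupI: "u \<in> \<Gamma> \<Longrightarrow> v \<in> \<Gamma> \<Longrightarrow> u - v \<in> difference_group"
  unfolding difference_group_def by blast

lemma semigroup_subset_difference_group: "u \<in> \<Gamma> \<Longrightarrow> u \<in> difference_group"
  using difference_groupI[of "u + u" u] add_closed by simp

lemma difference_group_diff:
  assumes "x \<in> difference_group" "y \<in> difference_group"
  shows "x - y \<in> difference_group"
proof -
  obtain u v u' v' where "x = u - v" "y = u' - v'" "u \<in> \<Gamma>" "v \<in> \<Gamma>" "u' \<in> \<Gamma>" "v' \<in> \<Gamma>"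
    using assms unfolding difference_group_def by blast
  moreover have "(u - v) - (u' - v') = (u + v') - (v + u')" by simp
  ultimately show ?thesis
    using difference_groupI[of "u + v'" "v + u'"] add_closed by metis
qed

lemma difference_group_integral:
  assumes "x \<in> difference_group" "b \<in> Basis"
  shows "x \<bullet> b \<in> \<int>"
proof -
  obtain u v where "x = u - v" "u \<in> \<Gamma>" "v \<in> \<Gamma>"
    using assms(1) unfolding difference_group_def by blast
  then show ?thesis using integral assms(2) by (simp add: inner_diff_left)
qed

lemma add_multiple:
  assumes "u \<in> \<Gamma>" "g \<in> \<Gamma>"
  shows "u + real n *\<^sub>R g \<in> \<Gamma>" and "F (u + real n *\<^sub>R g) \<le> F u + real n * F g"
proof -
  have "u + real n *\<^sub>R g \<in> \<Gamma> \<and> F (u + real n *\<^sub>R g) \<le> F u + real n * F g"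
  proof (induction n)
    case 0
    then show ?case using assms by simp
  next
    case (Suc n)
    have "u + real (Suc n) *\<^sub>R g = (u + real n *\<^sub>R g) + g"
      by (simp add: algebra_simps)
    then show ?case
      using Suc add_closed[of "u + real n *\<^sub>R g" g] subadditive[of "u + real n *\<^sub>R g" g] assms
      by (auto simp: algebra_simps)
  qed
  then show "u + real n *\<^sub>R g \<in> \<Gamma>" "F (u + real n *\<^sub>R g) \<le> F u + real n * F g"
    by auto
qed

lemma add_multiple_diff:
  assumes "g \<in> \<Gamma>" "x \<in> difference_group"
  shows "x - real n *\<^sub>R g \<in> difference_group"
proof (induction n)
  case (Suc n)
  then show ?case
    using difference_group_diff[of "x - real n *\<^sub>R g" g] assms semigroup_subset_difference_group
    by (simp add: algebra_simps)
qed (use assms in simp)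

lemma add_combination:
  assumes "finite T" "T \<subseteq> \<Gamma>" "u \<in> \<Gamma>"
  shows "u + (\<Sum>g\<in>T. real (n g) *\<^sub>R g) \<in> \<Gamma> \<and>
         F (u + (\<Sum>g\<in>T. real (n g) *\<^sub>R g)) \<le> F u + (\<Sum>g\<in>T. real (n g) * F g)"
  using assms
proof (induction T)
  case (insert g T)
  let ?v = "u + (\<Sum>g\<in>T. real (n g) *\<^sub>R g)"
  have "u + (\<Sum>g\<in>insert g T. real (n g) *\<^sub>R g) = ?v + real (n g) *\<^sub>R g"
    using insert by (simp add: algebra_simps)
  moreover have "?v \<in> \<Gamma>" and F: "F ?v \<le> F u + (\<Sum>g\<in>T. real (n g) * F g)" and "g \<in> \<Gamma>"
    using insert by auto
  moreover have "F (?v + real (n g) *\<^sub>R g) \<le> F u + (\<Sum>g\<in>insert g T. real (n g) * F g)"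
    using add_multiple(2)[OF \<open>?v \<in> \<Gamma>\<close> \<open>g \<in> \<Gamma>\<close>, of "n g"] F insert.hyps by simp
  ultimately show ?case
    using add_multiple(1)[of ?v g "n g"] by (simp only:)
qed simp

lemma diff_combination:
  assumes "finite T" "T \<subseteq> \<Gamma>" "x \<in> difference_group"
  shows "x - (\<Sum>g\<in>T. real (n g) *\<^sub>R g) \<in> difference_group"
  using assms
proof (induction T)
  case (insert g T)
  let ?v = "x - (\<Sum>g\<in>T. real (n g) *\<^sub>R g)"
  have "x - (\<Sum>g\<in>insert g T. real (n g) *\<^sub>R g) = ?v - real (n g) *\<^sub>R g"
    using insert by (simp add: algebra_simps)
  moreover have "?v \<in> difference_group" "g \<in> \<Gamma>"
    using insert by auto
  ultimately show ?case
    using add_multiple_diff[of g ?v "n g"] by (simp only:)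
qed simp

text \<open>Elements \<open>u - v\<close> of the difference group enter the semigroup after a shift by \<open>v\<close>; the sum of the
  shifts for all \<open>w \<in> W\<close> works for all of them at once.\<close>

lemma common_shift:
  assumes "\<Gamma> \<noteq> {}" "finite W" "W \<subseteq> difference_group"
  shows "\<exists>c\<in>\<Gamma>. \<forall>w\<in>W. w + c \<in> \<Gamma>"
  using assms(2,3)
proof (induction W)
  case empty
  then show ?case using assms(1) by auto
next
  case (insert w W)
  then obtain c where c: "c \<in> \<Gamma>" "\<And>x. x \<in> W \<Longrightarrow> x + c \<in> \<Gamma>" by auto
  obtain u v where uv: "w = u - v" "u \<in> \<Gamma>" "v \<in> \<Gamma>"
    using insert by (auto simp: difference_group_def)
  have "w + (c + v) = u + c" using uv by simp
  then have "w + (c + v) \<in> \<Gamma>" using add_closed uv c by simp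
  moreover have "x + (c + v) \<in> \<Gamma>" if "x \<in> W" for x
    using add_closed[OF c(2)[OF that] uv(3)] by (simp add: add.assoc)
  ultimately show ?case using add_closed c uv by (intro bexI[of _ "c + v"]) auto
qed

definition slopes :: "'a set" where
  "slopes = (\<lambda>u. (1 / snd u) *\<^sub>R fst u) ` \<Gamma>"

lemma cone_around_interior_slope:
  assumes "p \<in> interior (closure (convex hull slopes))"
  obtains T \<rho> where "finite T" "T \<subseteq> \<Gamma>" "0 < \<rho>"
    "\<forall>v. 0 < snd v \<longrightarrow> dist ((1 / snd v) *\<^sub>R fst v) p < \<rho> \<longrightarrow>
         (\<exists>t. (\<forall>g\<in>T. 0 \<le> t g) \<and> v = (\<Sum>g\<in>T. t g *\<^sub>R g))"
proof -
  obtain S \<rho> where S: "finite S" "S \<subseteq> slopes" "0 < \<rho>" "ball p \<rho> \<subseteq> convex hull S"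
    using interior_convex_hull_finite_subset[OF assms] by metis
  obtain T where T: "T \<subseteq> \<Gamma>" "inj_on (\<lambda>u. (1 / snd u) *\<^sub>R fst u) T"
      "S = (\<lambda>u. (1 / snd u) *\<^sub>R fst u) ` T"
    using S(2) unfolding slopes_def subset_image_inj by blast
  have "finite T" using S(1) T(2,3) finite_image_iff by blast
  show ?thesis
  proof (rule that[OF \<open>finite T\<close> T(1) S(3)], intro allI impI)
    fix v :: "'a \<times> real"
    assume v: "0 < snd v" "dist ((1 / snd v) *\<^sub>R fst v) p < \<rho>"
    then have "(1 / snd v) *\<^sub>R fst v \<in> convex hull S"
      using S(4) by (auto simp: dist_commute)
    then obtain l where l: "\<forall>x\<in>S. 0 \<le> l x" "sum l S = 1" "(\<Sum>x\<in>S. l x *\<^sub>R x) = (1 / snd v) *\<^sub>R fst v"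
      unfolding convex_hull_finite[OF S(1)] by blast
    define m where "m g = l ((1 / snd g) *\<^sub>R fst g)" for g :: "'a \<times> real"
    define t where "t g = snd v * m g / snd g" for g
    have pos: "0 < snd g" if "g \<in> T" for g
      using level_ge_1[of g] T(1) that by auto
    have m: "\<forall>g\<in>T. 0 \<le> m g" "sum m T = 1"
        "(\<Sum>g\<in>T. m g *\<^sub>R (1 / snd g) *\<^sub>R fst g) = (1 / snd v) *\<^sub>R fst v"
      using l unfolding m_def T(3) by (simp_all add: sum.reindex[OF T(2)] o_def)
    have "fst (\<Sum>g\<in>T. t g *\<^sub>R g) = snd v *\<^sub>R (\<Sum>g\<in>T. m g *\<^sub>R (1 / snd g) *\<^sub>R fst g)"
      by (simp add: fst_sum t_def scaleR_sum_right)
    also have "\<dots> = fst v" using m(3) v by simp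
    finally have 1: "fst (\<Sum>g\<in>T. t g *\<^sub>R g) = fst v" .
    have "snd (\<Sum>g\<in>T. t g *\<^sub>R g) = (\<Sum>g\<in>T. snd v * m g)"
      unfolding snd_sum
    proof (rule sum.cong[OF refl])
      fix g assume "g \<in> T"
      from pos[OF this] show "snd (t g *\<^sub>R g) = snd v * m g" by (simp add: t_def)
    qed
    also have "\<dots> = snd v" using m(2) by (simp flip: sum_distrib_left)
    finally have 2: "snd (\<Sum>g\<in>T. t g *\<^sub>R g) = snd v" .
    have "\<forall>g\<in>T. 0 \<le> t g"
      unfolding t_def using m(1) pos v by (simp add: less_imp_le)
    with 1 2 show "\<exists>t. (\<forall>g\<in>T. 0 \<le> t g) \<and> v = (\<Sum>g\<in>T. t g *\<^sub>R g)"
      by (intro exI[of _ t]) (simp add: prod_eq_iff)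
  qed
qed

text \<open>If \<open>v\<close> lies in the difference group and \<open>v - c\<close> in the cone over the finite set \<open>T\<close>, then \<open>v - c\<close> is a
  nonnegative real combination of \<open>T\<close>.  Rounding the coefficients down leaves a remainder
  \<open>w\<close> in the difference group that is bounded independently of \<open>v\<close>, so only finitely many \<open>w\<close> occur.  With
  \<open>c\<close> chosen such that every \<open>w + c\<close> lies in \<open>\<Gamma>\<close>, the point \<open>v\<close> is \<open>w + c\<close> plus at most \<open>snd v\<close> copies of each
  element of \<open>T\<close>, and subadditivity bounds \<open>F v\<close>.\<close>

lemma deep_points_bounded:
  assumes "p \<in> interior (closure (convex hull slopes))"
  obtains c \<rho> K M where "c \<in> \<Gamma>" "0 < \<rho>" "0 \<le> K" "0 \<le> M"
    "\<forall>v\<in>difference_group. snd c < snd v \<longrightarrow>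
         dist ((1 / snd (v - c)) *\<^sub>R fst (v - c)) p < \<rho> \<longrightarrow> v \<in> \<Gamma> \<and> F v \<le> K * snd v + M"
proof -
  obtain T \<rho> where T: "finite T" "T \<subseteq> \<Gamma>" "0 < \<rho>"
    "\<forall>v. 0 < snd v \<longrightarrow> dist ((1 / snd v) *\<^sub>R fst v) p < \<rho> \<longrightarrow>
         (\<exists>t. (\<forall>g\<in>T. 0 \<le> t g) \<and> v = (\<Sum>g\<in>T. t g *\<^sub>R g))"
    using cone_around_interior_slope[OF assms] by blast
  have ne: "\<Gamma> \<noteq> {}" using assms by (auto simp: slopes_def)
  define W where "W = {w \<in> difference_group. norm w \<le> (\<Sum>g\<in>T. norm g)}"
  have "finite W"
    by (rule finite_subset[OF _ finite_bounded_integral_vectors[of "\<Sum>g\<in>T. norm g"]])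
       (use difference_group_integral in \<open>auto simp: W_def\<close>)
  then obtain c where c: "c \<in> \<Gamma>" "\<And>w. w \<in> W \<Longrightarrow> w + c \<in> \<Gamma>"
    using common_shift[OF ne, of W] by (auto simp: W_def)
  define K where "K = (\<Sum>g\<in>T. \<bar>F g\<bar>)"
  define M where "M = (\<Sum>w\<in>W. \<bar>F (w + c)\<bar>)"
  show ?thesis
  proof (rule that[OF c(1) T(3)])
    show "0 \<le> K" "0 \<le> M" by (auto simp: K_def M_def sum_nonneg)
    show "\<forall>v\<in>difference_group. snd c < snd v \<longrightarrow>
         dist ((1 / snd (v - c)) *\<^sub>R fst (v - c)) p < \<rho> \<longrightarrow> v \<in> \<Gamma> \<and> F v \<le> K * snd v + M"
    proof (intro ballI impI)
    fix v assume v: "v \<in> difference_group" "snd c < snd v"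
      "dist ((1 / snd (v - c)) *\<^sub>R fst (v - c)) p < \<rho>"
    then obtain t where t: "\<forall>g\<in>T. 0 \<le> t g" "v - c = (\<Sum>g\<in>T. t g *\<^sub>R g)"
      using T(4)[rule_format, of "v - c"] by auto
    define n where "n g = nat \<lfloor>t g\<rfloor>" for g
    define w where "w = v - c - (\<Sum>g\<in>T. real (n g) *\<^sub>R g)"
    have n: "real (n g) \<le> t g" "t g - real (n g) \<le> 1" if "g \<in> T" for g
      using t(1) that unfolding n_def by (auto simp: of_nat_nat) linarith+
    have "w \<in> W"
    proof -
      have "w \<in> difference_group"
        unfolding w_def using v c T semigroup_subset_difference_group
        by (intro diff_combination difference_group_diff) auto
      moreover have "w = (\<Sum>g\<in>T. (t g - real (n g)) *\<^sub>R g)"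
        unfolding w_def t(2) by (simp add: scaleR_diff_left sum_subtractf)
      then have "norm w \<le> (\<Sum>g\<in>T. norm ((t g - real (n g)) *\<^sub>R g))"
        by (simp only: norm_sum)
      moreover have "(\<Sum>g\<in>T. norm ((t g - real (n g)) *\<^sub>R g)) \<le> (\<Sum>g\<in>T. norm g)"
      proof (rule sum_mono)
        fix g assume "g \<in> T"
        then have "\<bar>t g - real (n g)\<bar> \<le> 1" using n[of g] by simp
        then show "norm ((t g - real (n g)) *\<^sub>R g) \<le> norm g"
          using mult_right_mono[of "\<bar>t g - real (n g)\<bar>" 1 "norm g"] by simp
      qed
      ultimately show ?thesis by (simp add: W_def)
    qed
    have v_eq: "v = (w + c) + (\<Sum>g\<in>T. real (n g) *\<^sub>R g)" by (simp add: w_def)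
    have *: "v \<in> \<Gamma>" "F v \<le> F (w + c) + (\<Sum>g\<in>T. real (n g) * F g)"
      using add_combination[OF T(1,2) c(2)[OF \<open>w \<in> W\<close>], of n] unfolding v_eq[symmetric] by auto
    have "F (w + c) \<le> \<bar>F (w + c)\<bar>" by simp
    also have "\<dots> \<le> M"
      unfolding M_def using \<open>w \<in> W\<close> \<open>finite W\<close>
      by (intro member_le_sum[of w W "\<lambda>w. \<bar>F (w + c)\<bar>"]) auto
    finally have 1: "F (w + c) \<le> M" .
    have lev: "real (n g) \<le> snd v" if g: "g \<in> T" for g
    proof -
      have ge: "1 \<le> snd h" if "h \<in> T" for h
        using level_ge_1[of h] T(2) that by auto
      have "real (n g) \<le> t g * snd g"
      proof -
        have "t g * 1 \<le> t g * snd g" using t(1) g ge[OF g] by (intro mult_left_mono) auto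
        then show ?thesis using n(1)[OF g] by linarith
      qed
      also have "\<dots> \<le> (\<Sum>g\<in>T. t g * snd g)"
      proof (rule member_le_sum[OF g _ T(1)])
        fix h assume "h \<in> T - {g}"
        then show "0 \<le> t h * snd h" using t(1) ge[of h] by auto
      qed
      also have "\<dots> = snd (v - c)" unfolding t(2) by (simp add: snd_sum)
      also have "\<dots> \<le> snd v" using level_ge_1[OF c(1)] by simp
      finally show ?thesis .
    qed
    have "(\<Sum>g\<in>T. real (n g) * F g) \<le> (\<Sum>g\<in>T. snd v * \<bar>F g\<bar>)"
    proof (rule sum_mono)
      fix g assume "g \<in> T"
      have "real (n g) * F g \<le> real (n g) * \<bar>F g\<bar>" by (intro mult_left_mono) auto
      also have "\<dots> \<le> snd v * \<bar>F g\<bar>" using lev[OF \<open>g \<in> T\<close>] by (intro mult_right_mono) auto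
      finally show "real (n g) * F g \<le> snd v * \<bar>F g\<bar>" .
    qed
    also have "\<dots> = K * snd v" unfolding K_def by (simp only: sum_distrib_left mult.commute)
    finally show "v \<in> \<Gamma> \<and> F v \<le> K * snd v + M" using * 1 by simp
    qed
  qed
qed

text \<open>The remainder \<open>k \<beta> - q m \<alpha> - c\<close> has level at least \<open>\<epsilon> k / 2\<close>, while its distance from the ray through \<open>p\<close>
  is at most \<open>k\<close> times the deviations of \<open>\<alpha>\<close> and \<open>\<beta>\<close> from \<open>p\<close>, plus a constant.  Dividing shows how
  close to \<open>p\<close> the slopes \<open>\<alpha>\<close>, \<open>\<beta>\<close> have to be for a given \<open>\<epsilon>\<close>.\<close>

lemma remainder_slope:
  fixes \<beta> \<alpha> p c :: 'a
  assumes "0 < \<epsilon>" "0 < \<rho>" "0 < m" "q * m \<le> (1 - \<epsilon>) * k" "0 \<le> q" "0 < k"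
    and "norm (\<beta> - p) < \<epsilon> * \<rho> / 8" "norm (\<alpha> - p) < \<epsilon> * \<rho> / 8"
    and "2 * l \<le> \<epsilon> * k" "4 * norm (c - l *\<^sub>R p) < \<epsilon> * \<rho> * k"
  shows "dist ((1 / (k - q * m - l)) *\<^sub>R (k *\<^sub>R \<beta> - (q * m) *\<^sub>R \<alpha> - c)) p < \<rho>"
proof -
  define d where "d = k - q * m - l"
  have d: "\<epsilon> * k / 2 \<le> d" using assms(4,9) by (simp add: d_def algebra_simps)
  have d0: "0 < d" using d mult_pos_pos[OF assms(1,6)] by linarith
  have qm: "q * m \<le> k"
  proof -
    have "(1 - \<epsilon>) * k \<le> k" using mult_pos_pos[OF assms(1,6)] by (simp add: left_diff_distrib)
    then show ?thesis using assms(4) by linarith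
  qed
  have "(1 / d) *\<^sub>R (k *\<^sub>R \<beta> - (q * m) *\<^sub>R \<alpha> - c) - p
        = (1 / d) *\<^sub>R (k *\<^sub>R (\<beta> - p) - (q * m) *\<^sub>R (\<alpha> - p) - (c - l *\<^sub>R p))"
  proof -
    have "p = (1 / d) *\<^sub>R (d *\<^sub>R p)" using d0 by simp
    also have "d *\<^sub>R p = k *\<^sub>R p - (q * m) *\<^sub>R p - l *\<^sub>R p" by (simp add: d_def scaleR_diff_left)
    finally have "(1 / d) *\<^sub>R (k *\<^sub>R \<beta> - (q * m) *\<^sub>R \<alpha> - c) - p
       = (1 / d) *\<^sub>R ((k *\<^sub>R \<beta> - (q * m) *\<^sub>R \<alpha> - c) - (k *\<^sub>R p - (q * m) *\<^sub>R p - l *\<^sub>R p))"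
      by (metis scaleR_diff_right)
    then show ?thesis by (simp add: scaleR_diff_right algebra_simps)
  qed
  moreover have "norm (k *\<^sub>R (\<beta> - p) - (q * m) *\<^sub>R (\<alpha> - p) - (c - l *\<^sub>R p)) < \<rho> * d"
  proof -
    have "norm (k *\<^sub>R (\<beta> - p) - (q * m) *\<^sub>R (\<alpha> - p) - (c - l *\<^sub>R p))
        \<le> norm (k *\<^sub>R (\<beta> - p)) + norm ((q * m) *\<^sub>R (\<alpha> - p)) + norm (c - l *\<^sub>R p)"
      by (meson norm_triangle_ineq4 norm_triangle_le_diff add_mono order_refl order_trans)
    also have "\<dots> = k * norm (\<beta> - p) + (q * m) * norm (\<alpha> - p) + norm (c - l *\<^sub>R p)"
      using assms by simp
    also have "\<dots> \<le> k * (\<epsilon> * \<rho> / 8) + k * (\<epsilon> * \<rho> / 8) + norm (c - l *\<^sub>R p)"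
      using assms qm by (intro add_mono mult_mono) auto
    also have "\<dots> < \<rho> * (\<epsilon> * k / 2)"
      using assms(10) by (simp add: algebra_simps)
    also have "\<dots> \<le> \<rho> * d" using d assms(2) by (intro mult_left_mono) auto
    finally show ?thesis .
  qed
  ultimately have "norm ((1 / d) *\<^sub>R (k *\<^sub>R \<beta> - (q * m) *\<^sub>R \<alpha> - c) - p) < \<rho>"
    using d0 by (simp add: divide_less_eq)
  then show ?thesis
    by (simp only: dist_norm d_def)
qed

lemma lower_bound_near:
  assumes "a \<in> \<Gamma>" "- C * norm a \<le> F a" "dist ((1 / snd a) *\<^sub>R fst a) p < r"
  shows "- (\<bar>C\<bar> * (norm p + r + 1)) \<le> F a / snd a"
proof -
  have s: "1 \<le> snd a" using level_ge_1 assms by blast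
  have "norm ((1 / snd a) *\<^sub>R fst a) \<le> norm p + r"
    using assms(3) norm_triangle_ineq2[of "(1 / snd a) *\<^sub>R fst a" p] by (simp add: dist_norm)
  then have "norm (fst a) \<le> (norm p + r) * snd a"
    using s by (simp add: field_simps)
  moreover have "norm a \<le> norm (fst a) + norm (snd a)"
    using norm_Pair_le[of "fst a" "snd a"] by simp
  ultimately have na: "norm a \<le> (norm p + r + 1) * snd a"
    using s by (simp add: algebra_simps)
  have "C * norm a \<le> \<bar>C\<bar> * norm a" by (intro mult_right_mono) auto
  also have "\<dots> \<le> \<bar>C\<bar> * (norm p + r + 1) * snd a"
    using mult_left_mono[OF na, of "\<bar>C\<bar>"] by (simp add: mult.assoc)
  finally have "- (\<bar>C\<bar> * (norm p + r + 1)) * snd a \<le> F a" using assms(2) by simp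
  then show ?thesis using s by (subst pos_le_divide_eq) auto
qed

text \<open>The heart of the Fekete argument.  The radius \<open>\<delta>\<close> depends only on \<open>\<epsilon>\<close>, so \<open>a\<close> can be chosen freely near
  \<open>p\<close> before the level of \<open>b\<close> is sent to infinity; the constant \<open>K\<close> depends on neither.\<close>

lemma near_comparison:
  assumes p: "p \<in> interior (closure (convex hull slopes))"
    and lower: "\<And>u. u \<in> \<Gamma> \<Longrightarrow> - C * norm u \<le> F u"
  shows "\<exists>K\<ge>0. \<forall>\<epsilon>. 0 < \<epsilon> \<longrightarrow> \<epsilon> < 1 \<longrightarrow> (\<exists>\<delta>>0. \<forall>a\<in>\<Gamma>. dist ((1 / snd a) *\<^sub>R fst a) p < \<delta> \<longrightarrow>
     (\<exists>N. \<forall>b\<in>\<Gamma>. dist ((1 / snd b) *\<^sub>R fst b) p < \<delta> \<longrightarrow> N < snd b \<longrightarrow>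
        F b / snd b \<le> F a / snd a + \<epsilon> * K))"
proof -
  obtain c \<rho> K M where c: "c \<in> \<Gamma>" "0 < \<rho>" "0 \<le> K" "0 \<le> M"
    and deep: "\<forall>v\<in>difference_group. snd c < snd v \<longrightarrow>
         dist ((1 / snd (v - c)) *\<^sub>R fst (v - c)) p < \<rho> \<longrightarrow> v \<in> \<Gamma> \<and> F v \<le> K * snd v + M"
    using deep_points_bounded[OF p] by blast
  define B where "B = \<bar>C\<bar> * (norm p + \<rho> + 1)"
  have B: "0 \<le> B" using c(2) by (simp add: B_def)
  have Fa: "- B \<le> F a / snd a" if "a \<in> \<Gamma>" "dist ((1 / snd a) *\<^sub>R fst a) p < \<rho>" for a
    using lower_bound_near[OF that(1) lower[OF that(1)] that(2)] by (simp add: B_def)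
  show ?thesis
  proof (rule exI[of _ "K + B + 1"], intro conjI allI impI)
    show "0 \<le> K + B + 1" using c B by simp
    fix \<epsilon> :: real assume \<epsilon>: "0 < \<epsilon>" "\<epsilon> < 1"
    define \<delta> where "\<delta> = \<epsilon> * \<rho> / 8"
    have \<delta>: "0 < \<delta>" using \<epsilon> c by (simp add: \<delta>_def)
    have "\<delta> \<le> \<rho>" using \<epsilon> c mult_right_mono[of \<epsilon> 1 \<rho>] by (simp add: \<delta>_def)
    have "\<exists>N. \<forall>b\<in>\<Gamma>. dist ((1 / snd b) *\<^sub>R fst b) p < \<delta> \<longrightarrow> N < snd b \<longrightarrow>
        F b / snd b \<le> F a / snd a + \<epsilon> * (K + B + 1)"
      if a: "a \<in> \<Gamma>" "dist ((1 / snd a) *\<^sub>R fst a) p < \<delta>" for a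
    proof -
      define m where "m = snd a"
      define l where "l = snd c"
      have m: "1 \<le> m" using a level_ge_1 by (simp add: m_def)
      have l: "1 \<le> l" using c level_ge_1 by (simp add: l_def)
      \<comment> \<open>The three summands make the level large enough for the cone condition (twice) and make the bounded errors at most \<open>\<epsilon> k\<close>.\<close>
      define N where "N = 2 * l / \<epsilon> + 4 * norm (fst c - l *\<^sub>R p) / (\<epsilon> * \<rho>) + (K * m + M + m * B) / \<epsilon>"
      have "F b / snd b \<le> F a / snd a + \<epsilon> * (K + B + 1)"
        if b: "b \<in> \<Gamma>" "dist ((1 / snd b) *\<^sub>R fst b) p < \<delta>" "N < snd b" for b
      proof -
        define k where "k = snd b"
        have k: "1 \<le> k" using b level_ge_1 by (simp add: k_def)
        have parts: "0 \<le> 2 * l / \<epsilon>" "0 \<le> 4 * norm (fst c - l *\<^sub>R p) / (\<epsilon> * \<rho>)"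
             "0 \<le> (K * m + M + m * B) / \<epsilon>"
          using l \<epsilon> c m B by auto
        have kN: "2 * l / \<epsilon> < k" "4 * norm (fst c - l *\<^sub>R p) / (\<epsilon> * \<rho>) < k" "(K * m + M + m * B) / \<epsilon> < k"
          using b(3) parts unfolding k_def N_def by linarith+
        have k1: "2 * l < \<epsilon> * k" "4 * norm (fst c - l *\<^sub>R p) < \<epsilon> * \<rho> * k" "K * m + M + m * B < \<epsilon> * k"
          using kN \<epsilon> c by (simp_all add: field_simps)
        \<comment> \<open>The largest multiple of \<open>a\<close> whose level does not exceed \<open>(1 - \<epsilon>) k\<close>.\<close>
        define q where "q = nat \<lfloor>(1 - \<epsilon>) * k / m\<rfloor>"
        have q0: "0 \<le> (1 - \<epsilon>) * k / m" using \<epsilon> k m by simp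
        have q1: "real q \<le> (1 - \<epsilon>) * k / m" "(1 - \<epsilon>) * k / m < real q + 1"
          using q0 unfolding q_def by (simp_all add: of_nat_nat)
        have q: "real q * m \<le> (1 - \<epsilon>) * k" "(1 - \<epsilon>) * k < real q * m + m"
          using q1 m by (simp_all add: field_simps)
        define v where "v = b - real q *\<^sub>R a"
        have sv: "snd v = k - real q * m" by (simp add: v_def k_def m_def)
        have v1: "v \<in> difference_group"
          unfolding v_def using a b semigroup_subset_difference_group add_multiple_diff by blast
        have v2: "snd c < snd v"
          using q(1) k1(1) l unfolding sv l_def[symmetric] by (simp add: algebra_simps)
        have fa: "fst a = m *\<^sub>R ((1 / snd a) *\<^sub>R fst a)" and fb: "fst b = k *\<^sub>R ((1 / snd b) *\<^sub>R fst b)"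
          using m k by (auto simp: m_def k_def)
        have "fst (v - c) = k *\<^sub>R ((1 / snd b) *\<^sub>R fst b) - (real q * m) *\<^sub>R ((1 / snd a) *\<^sub>R fst a) - fst c"
          unfolding v_def using fa fb by (metis (no_types, lifting) fst_diff fst_scaleR scaleR_scaleR)
        moreover have "snd (v - c) = k - real q * m - l" by (simp add: sv l_def)
        ultimately have v3: "dist ((1 / snd (v - c)) *\<^sub>R fst (v - c)) p < \<rho>"
          using remainder_slope[of \<epsilon> \<rho> m "real q" k "(1 / snd b) *\<^sub>R fst b" p "(1 / snd a) *\<^sub>R fst a" l "fst c"]
            \<epsilon> c(2) m k q(1) k1 a(2) b(2) unfolding \<delta>_def dist_norm by simp
        from deep v1 v2 v3 have v: "v \<in> \<Gamma>" "F v \<le> K * snd v + M" by auto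
        have "F b \<le> F v + real q * F a"
          using add_multiple(2)[OF v(1) a(1), of q] by (simp add: v_def)
        moreover have "K * snd v \<le> K * (\<epsilon> * k + m)"
          using q(2) c(3) unfolding sv by (intro mult_left_mono) (simp_all add: algebra_simps)
        \<comment> \<open>Since \<open>F a\<close> may be negative, replacing \<open>q m\<close> by \<open>k\<close> costs the lower bound \<open>B\<close> on the discarded level.\<close>
        moreover have "real q * F a \<le> k * (F a / m) + B * (\<epsilon> * k + m)"
        proof -
          have f: "- B \<le> F a / m" using Fa a \<open>\<delta> \<le> \<rho>\<close> by (auto simp: m_def)
          have "(1 - \<epsilon>) * k \<le> k" using k \<epsilon> by (simp add: left_diff_distrib)
          then have "real q * m \<le> k" using q(1) by linarith
          then have "(k - real q * m) * (- B) \<le> (k - real q * m) * (F a / m)"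
            using f by (intro mult_left_mono) auto
          moreover have "(k - real q * m) * B \<le> (\<epsilon> * k + m) * B"
            using B q(2) by (intro mult_right_mono) (auto simp: algebra_simps)
          moreover have "(k - real q * m) * (F a / m) = k * (F a / m) - real q * F a"
            using m by (simp add: field_simps)
          ultimately show ?thesis by (simp add: algebra_simps)
        qed
        ultimately have "F b \<le> k * (F a / m) + B * (\<epsilon> * k + m) + K * (\<epsilon> * k + m) + M"
          using v(2) by linarith
        also have "\<dots> \<le> k * (F a / m) + k * (\<epsilon> * (K + B + 1))"
          using k1(3) by (simp add: algebra_simps)
        finally have "F b \<le> k * (F a / m + \<epsilon> * (K + B + 1))" by (simp add: distrib_left)
        then show ?thesis using k by (simp add: k_def[symmetric] m_def[symmetric] divide_le_eq mult.commute)
      qed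
      then show ?thesis by blast
    qed
    then show "\<exists>\<delta>>0. \<forall>a\<in>\<Gamma>. dist ((1 / snd a) *\<^sub>R fst a) p < \<delta> \<longrightarrow>
     (\<exists>N. \<forall>b\<in>\<Gamma>. dist ((1 / snd b) *\<^sub>R fst b) p < \<delta> \<longrightarrow> N < snd b \<longrightarrow>
        F b / snd b \<le> F a / snd a + \<epsilon> * (K + B + 1))"
      using \<delta> by blast
  qed
qed

text \<open>Comparing two admissible sequences by \<open>near_comparison\<close> in both roles, the upper limit of each is at
  most the lower limit of the other.  Extended reals keep the argument free of case distinctions;
  finiteness follows from a single comparison and from the lower bound.\<close>

theorem normalized_limit_exists:
  assumes p: "p \<in> interior (closure (convex hull slopes))"
    and lower: "\<And>u. u \<in> \<Gamma> \<Longrightarrow> - C * norm u \<le> F u"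
  shows "\<exists>l. \<forall>a. (\<forall>\<^sub>F k in sequentially. a k \<in> \<Gamma>) \<longrightarrow> filterlim (\<lambda>k. snd (a k)) at_top sequentially \<longrightarrow>
     (\<lambda>k. (1 / snd (a k)) *\<^sub>R fst (a k)) \<longlonglongrightarrow> p \<longrightarrow> (\<lambda>k. F (a k) / snd (a k)) \<longlonglongrightarrow> l"
proof -
  define adm where "adm a \<longleftrightarrow> (\<forall>\<^sub>F k in sequentially. a k \<in> \<Gamma>) \<and> filterlim (\<lambda>k. snd (a k)) at_top sequentially \<and>
     (\<lambda>k. (1 / snd (a k)) *\<^sub>R fst (a k)) \<longlonglongrightarrow> p" for a :: "nat \<Rightarrow> 'a \<times> real"
  define \<phi> where "\<phi> a k = ereal (F (a k) / snd (a k))" for a :: "nat \<Rightarrow> 'a \<times> real" and k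
  obtain K where K: "0 \<le> K" and cmp: "\<And>\<epsilon>. 0 < \<epsilon> \<Longrightarrow> \<epsilon> < 1 \<Longrightarrow> (\<exists>\<delta>>0. \<forall>a\<in>\<Gamma>. dist ((1 / snd a) *\<^sub>R fst a) p < \<delta> \<longrightarrow>
     (\<exists>N. \<forall>b\<in>\<Gamma>. dist ((1 / snd b) *\<^sub>R fst b) p < \<delta> \<longrightarrow> N < snd b \<longrightarrow>
        F b / snd b \<le> F a / snd a + \<epsilon> * K))"
    using near_comparison[OF p lower] by blast
  have ev: "\<forall>\<^sub>F j in sequentially. limsup (\<phi> b) \<le> \<phi> a j + ereal (\<epsilon> * K)"
    if ab: "adm a" "adm b" and \<epsilon>: "0 < \<epsilon>" "\<epsilon> < 1" for a b \<epsilon>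
  proof -
    obtain \<delta> where \<delta>: "\<delta> > 0" "\<And>a. a \<in> \<Gamma> \<Longrightarrow> dist ((1 / snd a) *\<^sub>R fst a) p < \<delta> \<Longrightarrow>
     (\<exists>N. \<forall>b\<in>\<Gamma>. dist ((1 / snd b) *\<^sub>R fst b) p < \<delta> \<longrightarrow> N < snd b \<longrightarrow>
        F b / snd b \<le> F a / snd a + \<epsilon> * K)"
      using cmp[OF \<epsilon>] by blast
    have near: "\<forall>\<^sub>F k in sequentially. dist ((1 / snd (x k)) *\<^sub>R fst (x k)) p < \<delta>" if "adm x" for x
      using that \<delta>(1) tendstoD unfolding adm_def by fast
    have "\<forall>\<^sub>F j in sequentially. a j \<in> \<Gamma> \<and> dist ((1 / snd (a j)) *\<^sub>R fst (a j)) p < \<delta>"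
      using near[OF ab(1)] ab(1) unfolding adm_def by (auto intro: eventually_conj)
    then show ?thesis
    proof (rule eventually_mono)
      fix j assume j: "a j \<in> \<Gamma> \<and> dist ((1 / snd (a j)) *\<^sub>R fst (a j)) p < \<delta>"
      then obtain N where N: "\<And>b. b \<in> \<Gamma> \<Longrightarrow> dist ((1 / snd b) *\<^sub>R fst b) p < \<delta> \<Longrightarrow> N < snd b \<Longrightarrow>
        F b / snd b \<le> F (a j) / snd (a j) + \<epsilon> * K"
        using \<delta>(2)[of "a j"] by blast
      have big: "\<forall>\<^sub>F k in sequentially. N < snd (b k)"
        using ab(2) unfolding adm_def filterlim_at_top_dense by blast
      have bG: "\<forall>\<^sub>F k in sequentially. b k \<in> \<Gamma>"
        using ab(2) unfolding adm_def by blast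
      have "\<forall>\<^sub>F k in sequentially. \<phi> b k \<le> \<phi> a j + ereal (\<epsilon> * K)"
        using big bG near[OF ab(2)]
      proof eventually_elim
        case (elim k)
        then show ?case using N[of "b k"] by (simp add: \<phi>_def)
      qed
      then show "limsup (\<phi> b) \<le> \<phi> a j + ereal (\<epsilon> * K)"
        by (rule Limsup_bounded)
    qed
  qed
  have le: "limsup (\<phi> b) \<le> liminf (\<phi> a)" if ab: "adm a" "adm b" for a b
  proof (rule ereal_le_epsilon2)
    fix r :: real assume r: "0 < r"
    define \<epsilon> where "\<epsilon> = min (1/2) (r / (K + 1))"
    have \<epsilon>: "0 < \<epsilon>" "\<epsilon> < 1" using r K by (auto simp: \<epsilon>_def)
    have "\<epsilon> * K \<le> (r / (K + 1)) * K" using K by (intro mult_right_mono) (auto simp: \<epsilon>_def)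
    also have "\<dots> \<le> r" using K r by (simp add: field_simps)
    finally have eK: "\<epsilon> * K \<le> r" .
    have "\<forall>\<^sub>F j in sequentially. limsup (\<phi> b) - ereal (\<epsilon> * K) \<le> \<phi> a j"
      using ev[OF ab \<epsilon>] by (rule eventually_mono) (simp add: ereal_minus_le_iff add.commute)
    then have "limsup (\<phi> b) - ereal (\<epsilon> * K) \<le> liminf (\<phi> a)"
      by (rule Liminf_bounded)
    then have "limsup (\<phi> b) \<le> liminf (\<phi> a) + ereal (\<epsilon> * K)"
      by (simp add: ereal_minus_le_iff add.commute)
    also have "\<dots> \<le> liminf (\<phi> a) + ereal r"
      using eK by (intro add_left_mono) simp
    finally show "limsup (\<phi> b) \<le> liminf (\<phi> a) + ereal r" .
  qed
  show ?thesis
  proof (cases "\<exists>a. adm a")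
    case False
    then show ?thesis unfolding adm_def by blast
  next
    case True
    then obtain a where a: "adm a" by blast
    obtain j where j: "limsup (\<phi> a) \<le> \<phi> a j + ereal ((1/2) * K)"
      using eventually_happens[OF ev[OF a a, of "1/2"]] by auto
    have eq: "limsup (\<phi> b) = limsup (\<phi> a)" "liminf (\<phi> b) = limsup (\<phi> a)" if "adm b" for b
    proof -
      have "liminf (\<phi> x) \<le> limsup (\<phi> x)" for x by (simp add: Liminf_le_Limsup)
      then have "limsup (\<phi> b) \<le> limsup (\<phi> a)" "limsup (\<phi> a) \<le> liminf (\<phi> b)" "liminf (\<phi> b) \<le> limsup (\<phi> b)"
        using le[OF a that] le[OF that a] order_trans by blast+
      then show "limsup (\<phi> b) = limsup (\<phi> a)" "liminf (\<phi> b) = limsup (\<phi> a)"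
        by (auto intro: antisym)
    qed
    have "limsup (\<phi> a) \<noteq> \<infinity>" using j by (auto simp: \<phi>_def)
    moreover have "limsup (\<phi> a) \<noteq> - \<infinity>"
    proof -
      have "\<forall>\<^sub>F k in sequentially. ereal (- \<bar>C\<bar> * (norm p + 2)) \<le> \<phi> a k"
      proof -
        have "\<forall>\<^sub>F k in sequentially. dist ((1 / snd (a k)) *\<^sub>R fst (a k)) p < 1"
          using a tendstoD[of "\<lambda>k. (1 / snd (a k)) *\<^sub>R fst (a k)" p sequentially 1]
          unfolding adm_def by simp
        moreover have "\<forall>\<^sub>F k in sequentially. a k \<in> \<Gamma>" using a unfolding adm_def by blast
        ultimately show ?thesis
        proof eventually_elim
          case (elim k)
          then show ?case using lower_bound_near[of "a k" C p 1] lower by (simp add: \<phi>_def add.commute)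
        qed
      qed
      then have "ereal (- \<bar>C\<bar> * (norm p + 2)) \<le> liminf (\<phi> a)" by (rule Liminf_bounded)
      also have "\<dots> = limsup (\<phi> a)" by (rule eq(2)[OF a])
      finally show ?thesis by auto
    qed
    ultimately obtain l where l: "limsup (\<phi> a) = ereal l" by (cases "limsup (\<phi> a)") auto
    have "(\<lambda>k. F (b k) / snd (b k)) \<longlonglongrightarrow> l" if "adm b" for b
    proof -
      have "\<phi> b \<longlonglongrightarrow> ereal l"
        using eq[OF that] l by (intro Liminf_eq_Limsup) auto
      then show ?thesis by (simp add: \<phi>_def[abs_def])
    qed
    then show ?thesis unfolding adm_def by blast
  qed
qed

end

section \<open>The lowest coefficient in lexicographic order\<close>

text \<open>The Schwarz lemma: \<open>h(t)/t\<^sup>m\<close> extends holomorphically over \<open>0\<close> with value \<open>c\<close>, and the maximum principle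
  on circles of radius \<open>\<rho> \<rightarrow> 1\<close> bounds that value.\<close>

lemma leading_coefficient_bound:
  assumes h: "h holomorphic_on ball 0 1" and M: "\<And>t. t \<in> ball 0 1 \<Longrightarrow> cmod (h t) \<le> M"
    and lim: "((\<lambda>t. h t / t ^ m) \<longlongrightarrow> c) (at 0)"
  shows "cmod c \<le> M"
proof -
  define g where "g = (\<lambda>t. if t = 0 then c else h t / t ^ m)"
  have g: "g holomorphic_on ball 0 1"
  proof (rule no_isolated_singularity'[of "{0}"])
    have "(g \<longlongrightarrow> c) (at 0)"
      using lim by (rule Lim_transform_within[of _ _ _ _ 1]) (auto simp: g_def)
    then show "(g \<longlongrightarrow> g z) (at z within ball 0 1)" if "z \<in> {0}" for z
      using that by (auto simp: g_def intro: tendsto_within_subset)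
    have "(\<lambda>t. h t / t ^ m) holomorphic_on ball 0 1 - {0}"
      by (auto intro!: holomorphic_intros holomorphic_on_subset[OF h])
    then show "g holomorphic_on ball 0 1 - {0}"
      by (rule holomorphic_transform) (simp add: g_def)
  qed auto
  have *: "cmod c * \<rho> ^ m \<le> M" if \<rho>: "0 < \<rho>" "\<rho> < 1" for \<rho> :: real
  proof -
    have "cmod (g 0) \<le> M / \<rho> ^ m"
    proof (rule maximum_modulus_frontier[of g "cball 0 \<rho>"])
      have sub: "cball (0::complex) \<rho> \<subseteq> ball 0 1" using \<rho> by auto
      show "g holomorphic_on interior (cball 0 \<rho>)"
        using sub interior_subset by (blast intro: holomorphic_on_subset[OF g])
      show "continuous_on (closure (cball 0 \<rho>)) g"
        using holomorphic_on_imp_continuous_on[OF holomorphic_on_subset[OF g sub]] by simp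
      fix z :: complex assume "z \<in> frontier (cball 0 \<rho>)"
      then have z: "cmod z = \<rho>" using \<rho> by simp
      then have "z \<noteq> 0" "z \<in> ball 0 1" using \<rho> by auto
      then show "cmod (g z) \<le> M / \<rho> ^ m"
        using M[of z] \<rho> z by (simp add: g_def norm_divide norm_power divide_right_mono)
    qed (use \<rho> in auto)
    then show ?thesis using \<rho> by (simp add: g_def field_simps)
  qed
  have "((\<lambda>\<rho>. cmod c * \<rho> ^ m) \<longlongrightarrow> cmod c * 1 ^ m) (at_left 1)"
    by (intro tendsto_intros)
  moreover have "\<forall>\<^sub>F \<rho> in at_left (1::real). cmod c * \<rho> ^ m \<le> M"
    using eventually_at_left_real[of 0 1] by (auto elim!: eventually_mono intro: *)
  ultimately show ?thesis
    using tendsto_upperbound[of _ _ "at_left (1::real)" M] by fastforce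
qed

text \<open>The weights are powers of a base exceeding the sum of the entries of \<open>\<alpha>\<close>, as in a positional number system, with
  the most significant digit first.\<close>

definition lex_weight :: "nat ^ 'n::{finite,linorder} \<Rightarrow> 'n \<Rightarrow> nat" where
  "lex_weight \<alpha> l = (1 + (\<Sum>j\<in>UNIV. \<alpha> $ j)) ^ card {j. l < j}"

definition weighted_degree :: "('n::finite \<Rightarrow> nat) \<Rightarrow> nat ^ 'n \<Rightarrow> nat" where
  "weighted_degree w \<beta> = (\<Sum>l\<in>UNIV. w l * \<beta> $ l)"

lemma lex_less_trichotomy: "lex_less \<alpha> \<beta> \<or> \<alpha> = \<beta> \<or> lex_less \<beta> \<alpha>"
proof -
  have "less_fun (($) \<alpha>) (($) \<beta>) \<or> ($) \<alpha> = ($) \<beta> \<or> less_fun (($) \<beta>) (($) \<alpha>)"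
    by (rule less_fun_trichotomy) simp
  then show ?thesis
    unfolding lex_less_def by (simp only: vec_nth_inject)
qed

text \<open>At the first index \<open>k\<close> where \<open>\<beta>\<close> exceeds \<open>\<alpha>\<close> the weighted degree gains at least the weight of \<open>k\<close>, and all later
  entries of \<open>\<alpha>\<close> together weigh less than that.  The weights depend on \<open>\<alpha>\<close> alone, so they
  serve all \<open>\<beta>\<close> simultaneously.\<close>

lemma lex_weight_strict:
  fixes \<alpha> \<beta> :: "nat ^ 'n::{finite,linorder}"
  assumes "lex_less \<alpha> \<beta>"
  shows "weighted_degree (lex_weight \<alpha>) \<alpha> < weighted_degree (lex_weight \<alpha>) \<beta>"
proof -
  let ?w = "lex_weight \<alpha>"
  define A where "A = (\<Sum>j\<in>UNIV. \<alpha> $ j)"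
  obtain k where k: "\<alpha> $ k < \<beta> $ k" "\<And>l. l < k \<Longrightarrow> \<alpha> $ l = \<beta> $ l"
    using assms unfolding lex_less_def less_fun_def by blast
  have split: "weighted_degree ?w \<gamma> = (\<Sum>l\<in>{..<k}. ?w l * \<gamma> $ l) + (?w k * \<gamma> $ k + (\<Sum>l\<in>{k<..}. ?w l * \<gamma> $ l))" for \<gamma>
  proof -
    have "UNIV = {..<k} \<union> insert k {k<..}" by auto
    then have "weighted_degree ?w \<gamma> = (\<Sum>l\<in>{..<k} \<union> insert k {k<..}. ?w l * \<gamma> $ l)"
      by (simp add: weighted_degree_def)
    also have "\<dots> = (\<Sum>l\<in>{..<k}. ?w l * \<gamma> $ l) + (\<Sum>l\<in>insert k {k<..}. ?w l * \<gamma> $ l)"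
      by (rule sum.union_disjoint) auto
    finally show ?thesis by simp
  qed
  have "(\<Sum>l\<in>{k<..}. ?w l * \<alpha> $ l) < ?w k"
  proof (cases "{k<..} = {}")
    case True
    then show ?thesis by (simp only:) (simp add: lex_weight_def)
  next
    case False
    define c where "c = card {k<..}"
    have c: "0 < c" using False by (simp add: c_def card_gt_0_iff)
    have wk: "?w k = (1 + A) ^ c" by (simp add: lex_weight_def A_def c_def greaterThan_def)
    have "(\<Sum>l\<in>{k<..}. ?w l * \<alpha> $ l) \<le> (\<Sum>l\<in>{k<..}. (1 + A) ^ (c - 1) * \<alpha> $ l)"
    proof (rule sum_mono)
      fix l assume l: "l \<in> {k<..}"
      then have "{j. l < j} \<subset> {k<..}" by auto
      then have "card {j. l < j} < c" unfolding c_def by (intro psubset_card_mono) auto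
      then have "?w l \<le> (1 + A) ^ (c - 1)"
        unfolding lex_weight_def A_def by (intro power_increasing) auto
      then show "?w l * \<alpha> $ l \<le> (1 + A) ^ (c - 1) * \<alpha> $ l" by simp
    qed
    also have "\<dots> = (1 + A) ^ (c - 1) * (\<Sum>l\<in>{k<..}. \<alpha> $ l)" by (simp add: sum_distrib_left)
    also have "\<dots> \<le> (1 + A) ^ (c - 1) * A"
      unfolding A_def by (intro mult_left_mono sum_mono2) auto
    also have "\<dots> < (1 + A) ^ (c - 1) * (1 + A)" by simp
    also have "\<dots> = ?w k" unfolding wk using c by (metis Suc_pred' power_Suc2)
    finally show ?thesis .
  qed
  moreover have "?w k * \<alpha> $ k + ?w k \<le> ?w k * \<beta> $ k"
    using k(1) mult_le_mono2[of "Suc (\<alpha> $ k)" "\<beta> $ k" "?w k"] by simp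
  moreover have "(\<Sum>l\<in>{..<k}. ?w l * \<alpha> $ l) = (\<Sum>l\<in>{..<k}. ?w l * \<beta> $ l)"
    using k(2) by (intro sum.cong) auto
  ultimately show ?thesis unfolding split by linarith
qed

definition weighted_curve :: "('n::finite \<Rightarrow> nat) \<Rightarrow> real \<Rightarrow> complex \<Rightarrow> complex ^ 'n" where
  "weighted_curve w r t = (\<chi> l. of_real r * t ^ w l)"

lemma monomial_weighted_curve:
  "monomial (weighted_curve w r t) \<beta> = of_real r ^ (\<Sum>l\<in>UNIV. \<beta> $ l) * t ^ weighted_degree w \<beta>"
proof -
  have "monomial (weighted_curve w r t) \<beta> = (\<Prod>l\<in>UNIV. of_real r ^ (\<beta> $ l)) * (\<Prod>l\<in>UNIV. t ^ (w l * \<beta> $ l))"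
    by (simp add: monomial_def weighted_curve_def power_mult_distrib power_mult prod.distrib)
  then show ?thesis
    by (simp only: power_sum weighted_degree_def)
qed

lemma weighted_curve_has_derivative:
  "\<exists>d. (weighted_curve w r has_derivative (\<lambda>v. v *s d)) (at t)"
proof (intro exI)
  let ?d = "\<chi> l. of_real r * (of_nat (w l) * t ^ (w l - 1))"
  show "(weighted_curve w r has_derivative (\<lambda>v. v *s ?d)) (at t)"
  proof (rule has_derivative_componentwise_within[THEN iffD2], rule ballI)
    fix i :: "complex ^ 'a" assume "i \<in> Basis"
    then obtain l u where i: "i = axis l u"
      unfolding Basis_vec_def by blast
    have "((\<lambda>t. of_real r * t ^ w l) has_field_derivative of_real r * (of_nat (w l) * t ^ (w l - 1))) (at t)"
      by (auto intro!: derivative_eq_intros)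
    then have "((\<lambda>t. of_real r * t ^ w l) has_derivative (\<lambda>v. (of_real r * (of_nat (w l) * t ^ (w l - 1))) * v)) (at t)"
      by (simp add: has_field_derivative_def)
    then have "((\<lambda>t. (of_real r * t ^ w l) \<bullet> u) has_derivative (\<lambda>v. ((of_real r * (of_nat (w l) * t ^ (w l - 1))) * v) \<bullet> u)) (at t)"
      by (rule has_derivative_inner_left)
    then show "((\<lambda>t. weighted_curve w r t \<bullet> i) has_derivative (\<lambda>v. (v *s ?d) \<bullet> i)) (at t)"
      by (simp add: i inner_axis weighted_curve_def vector_scalar_mult_def mult_ac)
  qed
qed

lemma holomorphic_on_weighted_curve:
  assumes f: "holomorphic_cn f {z. \<forall>l. cmod (z $ l) < R}" and r: "0 \<le> r" "r < R"
  shows "(\<lambda>t. f (weighted_curve w r t)) holomorphic_on ball 0 1"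
proof -
  have "\<exists>D. ((\<lambda>t. f (weighted_curve w r t)) has_field_derivative D) (at t)" if t: "t \<in> ball 0 1" for t
  proof -
    have "cmod (weighted_curve w r t $ l) < R" for l
    proof -
      have "cmod t ^ w l \<le> 1" using t by (intro power_le_one) auto
      then have "r * cmod t ^ w l \<le> r" using r mult_left_mono[of _ 1 r] by simp
      then show ?thesis using r by (simp add: weighted_curve_def norm_mult norm_power)
    qed
    then obtain D where D: "(f has_derivative D) (at (weighted_curve w r t))" "\<And>c v. D (c *s v) = c * D v"
      using f unfolding holomorphic_cn_def by blast
    obtain d where d: "(weighted_curve w r has_derivative (\<lambda>v. v *s d)) (at t)"
      using weighted_curve_has_derivative by blast
    have "((\<lambda>t. f (weighted_curve w r t)) has_derivative (\<lambda>v. D (v *s d))) (at t)"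
      using has_derivative_compose[OF d D(1)] .
    then have "((\<lambda>t. f (weighted_curve w r t)) has_field_derivative D d) (at t)"
      unfolding D(2) has_field_derivative_def by (simp add: mult_commute_abs)
    then show ?thesis by blast
  qed
  then show ?thesis
    by (simp add: holomorphic_on_open)
qed

text \<open>On the curve every monomial is a power of \<open>t\<close>, and by the choice of weights all terms other than \<open>\<alpha>\<close>
  have exponent at least one more than that of \<open>\<alpha>\<close>.  Absolute convergence at a single \<open>t0 > 0\<close> bounds
  their sum by a multiple of \<open>t\<close> to that higher power.\<close>

lemma lowest_term_along_curve:
  fixes a :: "nat ^ 'n::{finite,linorder} \<Rightarrow> complex"
  assumes t0: "0 < t0" and r: "0 < r"
    and sums: "\<And>t. cmod t \<le> t0 \<Longrightarrow>
      ((\<lambda>\<beta>. a \<beta> * monomial (weighted_curve (lex_weight \<alpha>) r t) \<beta>) has_sum h t) UNIV"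
    and lowest: "\<And>\<beta>. lex_less \<beta> \<alpha> \<Longrightarrow> a \<beta> = 0"
  shows "((\<lambda>t. h t / t ^ weighted_degree (lex_weight \<alpha>) \<alpha>) \<longlongrightarrow>
            a \<alpha> * of_real r ^ (\<Sum>l\<in>UNIV. \<alpha> $ l)) (at 0)"
proof -
  let ?w = "lex_weight \<alpha>"
  define m where "m = weighted_degree ?w \<alpha>"
  define c where "c = a \<alpha> * of_real r ^ (\<Sum>l\<in>UNIV. \<alpha> $ l)"
  define b where "b \<beta> = a \<beta> * of_real r ^ (\<Sum>l\<in>UNIV. \<beta> $ l)" for \<beta>
  have term_eq: "a \<beta> * monomial (weighted_curve ?w r t) \<beta> = b \<beta> * t ^ weighted_degree ?w \<beta>" for \<beta> t
    by (simp add: monomial_weighted_curve b_def)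
  have "(\<lambda>\<beta>. b \<beta> * of_real t0 ^ weighted_degree ?w \<beta>) summable_on UNIV"
    using sums[of "of_real t0"] t0 unfolding term_eq by (auto simp: summable_on_def)
  then have "(\<lambda>\<beta>. norm (b \<beta> * of_real t0 ^ weighted_degree ?w \<beta>)) summable_on UNIV"
    by (rule summable_on_iff_abs_summable_on_complex[THEN iffD1])
  then have "(\<lambda>\<beta>. norm (b \<beta>) * t0 ^ weighted_degree ?w \<beta>) summable_on UNIV"
    using t0 by (simp add: norm_mult norm_power)
  then have sm: "(\<lambda>\<beta>. norm (b \<beta>) * t0 ^ weighted_degree ?w \<beta>) summable_on (UNIV - {\<alpha>})"
    by (rule summable_on_subset_banach) auto
  define S where "S = (\<Sum>\<^sub>\<infinity>\<beta>\<in>UNIV - {\<alpha>}. norm (b \<beta>) * t0 ^ weighted_degree ?w \<beta>)"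
  have S: "((\<lambda>\<beta>. norm (b \<beta>) * t0 ^ weighted_degree ?w \<beta>) has_sum S) (UNIV - {\<alpha>})"
    unfolding S_def using sm by (rule has_sum_infsum)
  have bound: "norm (h t - c * t ^ m) \<le> (cmod t / t0) ^ (m + 1) * S" if t: "cmod t \<le> t0" for t
  proof -
    have 1: "((\<lambda>\<beta>. b \<beta> * t ^ weighted_degree ?w \<beta>) has_sum h t - c * t ^ m) (UNIV - {\<alpha>})"
    proof (rule has_sum_Diff)
      show "((\<lambda>\<beta>. b \<beta> * t ^ weighted_degree ?w \<beta>) has_sum h t) UNIV"
        using sums[OF t] unfolding term_eq .
      show "((\<lambda>\<beta>. b \<beta> * t ^ weighted_degree ?w \<beta>) has_sum c * t ^ m) {\<alpha>}"
        using has_sum_finite[of "{\<alpha>}" "\<lambda>\<beta>. b \<beta> * t ^ weighted_degree ?w \<beta>"]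
        by (simp add: b_def c_def m_def)
    qed auto
    have 2: "norm (b \<beta> * t ^ weighted_degree ?w \<beta>)
        \<le> (cmod t / t0) ^ (m + 1) * (norm (b \<beta>) * t0 ^ weighted_degree ?w \<beta>)"
      if "\<beta> \<in> UNIV - {\<alpha>}" for \<beta>
    proof (cases "lex_less \<beta> \<alpha>")
      case True
      then show ?thesis using lowest by (simp add: b_def)
    next
      case False
      then have "lex_less \<alpha> \<beta>" using lex_less_trichotomy[of \<alpha> \<beta>] that by auto
      then have le: "m + 1 \<le> weighted_degree ?w \<beta>" using lex_weight_strict m_def by force
      have "cmod t ^ weighted_degree ?w \<beta> = (cmod t / t0) ^ weighted_degree ?w \<beta> * t0 ^ weighted_degree ?w \<beta>"
        using t0 by (simp add: power_divide)
      also have "\<dots> \<le> (cmod t / t0) ^ (m + 1) * t0 ^ weighted_degree ?w \<beta>"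
        using t t0 le by (intro mult_right_mono power_decreasing) auto
      finally have "norm (b \<beta>) * cmod t ^ weighted_degree ?w \<beta>
          \<le> norm (b \<beta>) * ((cmod t / t0) ^ (m + 1) * t0 ^ weighted_degree ?w \<beta>)"
        by (intro mult_left_mono) auto
      then show ?thesis by (simp add: norm_mult norm_power mult_ac)
    qed
    have 3: "((\<lambda>\<beta>. (cmod t / t0) ^ (m + 1) * (norm (b \<beta>) * t0 ^ weighted_degree ?w \<beta>)) has_sum
        (cmod t / t0) ^ (m + 1) * S) (UNIV - {\<alpha>})"
      using S by (rule has_sum_cmult_right)
    have "(\<lambda>\<beta>. norm (b \<beta> * t ^ weighted_degree ?w \<beta>)) summable_on (UNIV - {\<alpha>})"
      by (rule summable_on_iff_abs_summable_on_complex[THEN iffD1, OF has_sum_imp_summable[OF 1]])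
    then have 4: "((\<lambda>\<beta>. norm (b \<beta> * t ^ weighted_degree ?w \<beta>)) has_sum
        (\<Sum>\<^sub>\<infinity>\<beta>\<in>UNIV - {\<alpha>}. norm (b \<beta> * t ^ weighted_degree ?w \<beta>))) (UNIV - {\<alpha>})"
      by (rule has_sum_infsum)
    show ?thesis
      using norm_has_sum_bound[OF 4 1] has_sum_mono[OF 4 3 2] by linarith
  qed
  have "((\<lambda>t. h t / t ^ m - c) \<longlongrightarrow> 0) (at 0)"
  proof (rule Lim_null_comparison)
    have "\<forall>\<^sub>F t in at (0::complex). t \<in> ball 0 t0 - {0}"
      using t0 by (intro eventually_at_in_open) auto
    then show "\<forall>\<^sub>F t in at (0::complex). norm (h t / t ^ m - c) \<le> cmod t * (S / t0 ^ (m + 1))"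
    proof (rule eventually_mono)
      fix t :: complex assume t: "t \<in> ball 0 t0 - {0}"
      then have "h t / t ^ m - c = (h t - c * t ^ m) / t ^ m"
        by (simp add: diff_divide_distrib)
      then have "norm (h t / t ^ m - c) = norm (h t - c * t ^ m) / cmod t ^ m"
        by (simp add: norm_divide norm_power)
      also have "\<dots> \<le> ((cmod t / t0) ^ (m + 1) * S) / cmod t ^ m"
        using bound[of t] t by (intro divide_right_mono) auto
      also have "\<dots> = cmod t * (S / t0 ^ (m + 1))"
        using t by (simp add: power_divide)
      finally show "norm (h t / t ^ m - c) \<le> cmod t * (S / t0 ^ (m + 1))" .
    qed
    have "((\<lambda>t. cmod t * (S / t0 ^ (m + 1))) \<longlongrightarrow> cmod 0 * (S / t0 ^ (m + 1))) (at 0)"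
      by (intro tendsto_intros)
    then show "((\<lambda>t. cmod t * (S / t0 ^ (m + 1))) \<longlongrightarrow> 0) (at 0)" by simp
  qed
  then show ?thesis
    unfolding m_def[symmetric] c_def[symmetric] by (rule LIM_zero_cancel)
qed

text \<open>The expansion is assumed only on some polydisc of radius \<open>\<rho>\<close>, possibly much smaller than \<open>r\<close>: it
  identifies the leading behaviour of the restriction of \<open>f\<close> to the weighted curve at \<open>t = 0\<close>, while the bound comes from the
  holomorphy of that restriction on the whole unit disc.\<close>

theorem lex_lowest_coefficient_bound:
  fixes f :: "complex ^ 'n::{finite,linorder} \<Rightarrow> complex" and a :: "nat ^ 'n::{finite,linorder} \<Rightarrow> complex"
  assumes f: "holomorphic_cn f {z. \<forall>l. cmod (z $ l) < R}" and r: "0 < r" "r < R"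
    and M: "\<And>z. (\<And>l. cmod (z $ l) \<le> r) \<Longrightarrow> cmod (f z) \<le> M"
    and \<rho>: "0 < \<rho>"
    and sums: "\<And>z. (\<And>l. cmod (z $ l) < \<rho>) \<Longrightarrow> ((\<lambda>\<beta>. a \<beta> * monomial z \<beta>) has_sum f z) UNIV"
    and lowest: "\<And>\<beta>. lex_less \<beta> \<alpha> \<Longrightarrow> a \<beta> = 0"
  shows "cmod (a \<alpha>) * r ^ (\<Sum>l\<in>UNIV. \<alpha> $ l) \<le> M"
proof -
  let ?w = "lex_weight \<alpha>"
  have w: "1 \<le> ?w l" for l by (simp add: lex_weight_def)
  have small: "cmod (weighted_curve ?w r t $ l) \<le> r * cmod t" if "cmod t \<le> 1" for t l
  proof -
    have "cmod t ^ ?w l \<le> cmod t ^ 1" using that w by (intro power_decreasing) auto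
    then show ?thesis using r by (simp add: weighted_curve_def norm_mult norm_power)
  qed
  have "cmod (a \<alpha> * of_real r ^ (\<Sum>l\<in>UNIV. \<alpha> $ l)) \<le> M"
  proof (rule leading_coefficient_bound)
    show "(\<lambda>t. f (weighted_curve ?w r t)) holomorphic_on ball 0 1"
      using holomorphic_on_weighted_curve[OF f] r by simp
    show "cmod (f (weighted_curve ?w r t)) \<le> M" if "t \<in> ball 0 1" for t
    proof (rule M)
      fix l
      have "r * cmod t \<le> r" using that r mult_left_mono[of "cmod t" 1 r] by simp
      then show "cmod (weighted_curve ?w r t $ l) \<le> r" using small[of t l] that by simp
    qed
    define t0 where "t0 = min 1 (\<rho> / (2 * r))"
    have t0: "0 < t0" "t0 \<le> 1" "r * t0 < \<rho>" using r \<rho> by (auto simp: t0_def min_def field_simps)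
    show "((\<lambda>t. f (weighted_curve ?w r t) / t ^ weighted_degree ?w \<alpha>) \<longlongrightarrow>
            a \<alpha> * of_real r ^ (\<Sum>l\<in>UNIV. \<alpha> $ l)) (at 0)"
    proof (rule lowest_term_along_curve[OF t0(1) r(1) _ lowest])
      fix t assume t: "cmod t \<le> t0"
      show "((\<lambda>\<beta>. a \<beta> * monomial (weighted_curve ?w r t) \<beta>) has_sum f (weighted_curve ?w r t)) UNIV"
      proof (rule sums)
        fix l
        have "r * cmod t \<le> r * t0" using t r by simp
        then show "cmod (weighted_curve ?w r t $ l) < \<rho>" using small[of t l] t t0 by simp
      qed
    qed
  qed
  then show ?thesis using r by (simp add: norm_mult norm_power)
qed

section \<open>Products of power series\<close>

lemma lex_less_add_mono:
  assumes "lex_less \<alpha> \<alpha>'" "\<beta> = \<beta>' \<or> lex_less \<beta> \<beta>'"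
  shows "lex_less (\<alpha> + \<beta>) (\<alpha>' + \<beta>')"
proof -
  obtain k where k: "\<alpha> $ k < \<alpha>' $ k" "\<And>l. l < k \<Longrightarrow> \<alpha> $ l = \<alpha>' $ l"
    using assms(1) unfolding lex_less_def less_fun_def by blast
  show ?thesis
  proof (cases "\<beta> = \<beta>'")
    case True
    then show ?thesis unfolding lex_less_def using k by (intro less_funI exI[of _ k]) auto
  next
    case False
    then obtain j where j: "\<beta> $ j < \<beta>' $ j" "\<And>l. l < j \<Longrightarrow> \<beta> $ l = \<beta>' $ l"
      using assms(2) unfolding lex_less_def less_fun_def by blast
    show ?thesis unfolding lex_less_def
    proof (rule less_funI, rule exI[of _ "min j k"], intro conjI allI impI)
      show "(\<alpha> + \<beta>) $ min j k < (\<alpha>' + \<beta>') $ min j k"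
        using j k by (cases j k rule: linorder_cases) (auto simp: min_def add_strict_mono)
      show "(\<alpha> + \<beta>) $ l = (\<alpha>' + \<beta>') $ l" if "l < min j k" for l
        using j(2)[of l] k(2)[of l] that by simp
    qed
  qed
qed

lemma finite_smaller_multi_indices: "finite {\<alpha> :: nat ^ 'n::finite. \<forall>l. \<alpha> $ l \<le> \<gamma> $ l}"
proof (rule finite_subset)
  show "{\<alpha> :: nat ^ 'n. \<forall>l. \<alpha> $ l \<le> \<gamma> $ l} \<subseteq> vec_lambda ` (\<Pi>\<^sub>E l\<in>UNIV. {..\<gamma> $ l})"
  proof
    fix \<alpha> :: "nat ^ 'n" assume "\<alpha> \<in> {\<alpha>. \<forall>l. \<alpha> $ l \<le> \<gamma> $ l}"
    then have "(\<lambda>l. \<alpha> $ l) \<in> (\<Pi>\<^sub>E l\<in>UNIV. {..\<gamma> $ l})" by (auto simp: PiE_iff)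
    moreover have "\<alpha> = vec_lambda (\<lambda>l. \<alpha> $ l)" by (simp add: vec_eq_iff)
    ultimately show "\<alpha> \<in> vec_lambda ` (\<Pi>\<^sub>E l\<in>UNIV. {..\<gamma> $ l})" by blast
  qed
qed (intro finite_imageI finite_PiE, auto)

definition cauchy_product ::
  "(nat ^ 'n::finite \<Rightarrow> complex) \<Rightarrow> (nat ^ 'n \<Rightarrow> complex) \<Rightarrow> nat ^ 'n \<Rightarrow> complex" where
  "cauchy_product a b \<gamma> = (\<Sum>\<alpha> | \<forall>l. \<alpha> $ l \<le> \<gamma> $ l. a \<alpha> * b (\<gamma> - \<alpha>))"

lemma monomial_add: "monomial z (\<alpha> + \<beta>) = monomial z \<alpha> * monomial z \<beta>"
  by (simp add: monomial_def power_add prod.distrib)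

lemma has_sum_times:
  fixes f :: "'a \<Rightarrow> complex" and g :: "'b \<Rightarrow> complex"
  assumes f: "(f has_sum x) A" and g: "(g has_sum y) B"
  shows "((\<lambda>(i, j). f i * g j) has_sum x * y) (A \<times> B)"
proof (rule has_sum_SigmaI)
  show "((\<lambda>j. case (i, j) of (i, j) \<Rightarrow> f i * g j) has_sum f i * y) B" for i
    using has_sum_cmult_right[OF g] by simp
  show "((\<lambda>i. f i * y) has_sum x * y) A"
    using has_sum_cmult_left[OF f] .
  have fa: "(\<lambda>i. norm (f i)) summable_on A" and ga: "(\<lambda>j. norm (g j)) summable_on B"
    by (rule summable_on_iff_abs_summable_on_complex[THEN iffD1, OF has_sum_imp_summable[OF f]],
        rule summable_on_iff_abs_summable_on_complex[THEN iffD1, OF has_sum_imp_summable[OF g]])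
  have "(\<lambda>p. norm (case p of (i, j) \<Rightarrow> f i * g j)) summable_on (A \<times> B)"
  proof (rule Infinite_Sum.abs_summable_on_Sigma_iff[THEN iffD2], intro conjI ballI)
    show "(\<lambda>j. norm (case (i, j) of (i, j) \<Rightarrow> f i * g j)) summable_on B" for i
      using ga by (simp add: norm_mult summable_on_cmult_right)
    have "(\<Sum>\<^sub>\<infinity>j\<in>B. norm (case (i, j) of (i, j) \<Rightarrow> f i * g j)) = norm (f i) * (\<Sum>\<^sub>\<infinity>j\<in>B. norm (g j))" for i
      by (simp add: norm_mult infsum_cmult_right')
    moreover have "0 \<le> (\<Sum>\<^sub>\<infinity>j\<in>B. norm (g j))" by (rule infsum_nonneg) simp
    ultimately show "(\<lambda>i. norm (\<Sum>\<^sub>\<infinity>j\<in>B. norm (case (i, j) of (i, j) \<Rightarrow> f i * g j))) summable_on A"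
      using fa by (simp add: summable_on_cmult_left)
  qed
  then show "(\<lambda>(i, j). f i * g j) summable_on (A \<times> B)"
    by (rule abs_summable_summable)
qed

lemma has_sum_cauchy_product:
  fixes a b :: "nat ^ 'n::finite \<Rightarrow> complex"
  assumes a: "((\<lambda>\<alpha>. a \<alpha> * monomial z \<alpha>) has_sum x) UNIV"
    and b: "((\<lambda>\<beta>. b \<beta> * monomial z \<beta>) has_sum y) UNIV"
  shows "((\<lambda>\<gamma>. cauchy_product a b \<gamma> * monomial z \<gamma>) has_sum x * y) UNIV"
proof -
  let ?B = "\<lambda>\<gamma>::nat ^ 'n. {\<alpha>. \<forall>l. \<alpha> $ l \<le> \<gamma> $ l}"
  have split: "\<alpha> + (\<gamma> - \<alpha>) = \<gamma>" if "\<alpha> \<in> ?B \<gamma>" for \<alpha> \<gamma>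
    using that by (auto simp: vec_eq_iff)
  have "((\<lambda>(\<gamma>, \<alpha>). (a \<alpha> * monomial z \<alpha>) * (b (\<gamma> - \<alpha>) * monomial z (\<gamma> - \<alpha>))) has_sum x * y) (Sigma UNIV ?B)"
    using has_sum_times[OF a b]
    by (subst has_sum_reindex_bij_witness[where T = "UNIV \<times> UNIV" and s' = "x * y"
         and j = "\<lambda>(\<gamma>, \<alpha>). (\<alpha>, \<gamma> - \<alpha>)" and i = "\<lambda>(\<alpha>, \<beta>). (\<alpha> + \<beta>, \<alpha>)"])
       (auto simp: vec_eq_iff)
  then have "((\<lambda>\<gamma>. \<Sum>\<alpha>\<in>?B \<gamma>. (a \<alpha> * monomial z \<alpha>) * (b (\<gamma> - \<alpha>) * monomial z (\<gamma> - \<alpha>))) has_sum x * y) UNIV"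
    by (rule has_sum_SigmaD) (simp add: finite_smaller_multi_indices)
  moreover have "(\<Sum>\<alpha>\<in>?B \<gamma>. (a \<alpha> * monomial z \<alpha>) * (b (\<gamma> - \<alpha>) * monomial z (\<gamma> - \<alpha>)))
      = cauchy_product a b \<gamma> * monomial z \<gamma>" for \<gamma>
    unfolding cauchy_product_def sum_distrib_right
  proof (rule sum.cong[OF refl])
    fix \<alpha> assume "\<alpha> \<in> ?B \<gamma>"
    then have "monomial z \<gamma> = monomial z \<alpha> * monomial z (\<gamma> - \<alpha>)"
      using split monomial_add by metis
    then show "(a \<alpha> * monomial z \<alpha>) * (b (\<gamma> - \<alpha>) * monomial z (\<gamma> - \<alpha>)) = a \<alpha> * b (\<gamma> - \<alpha>) * monomial z \<gamma>"
      by simp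
  qed
  ultimately show ?thesis by simp
qed

text \<open>Addition is strictly monotone for the lexicographic order, so the only possibly nonzero product contributing
  to an index up to \<open>\<alpha> + \<beta>\<close> is that of the two lowest terms.\<close>

lemma cauchy_product_lowest:
  fixes a b :: "nat ^ 'n::{finite,linorder} \<Rightarrow> complex"
  assumes a: "\<And>\<gamma>. lex_less \<gamma> \<alpha> \<Longrightarrow> a \<gamma> = 0" and b: "\<And>\<gamma>. lex_less \<gamma> \<beta> \<Longrightarrow> b \<gamma> = 0"
  shows "cauchy_product a b (\<alpha> + \<beta>) = a \<alpha> * b \<beta>"
    and "lex_less \<gamma> (\<alpha> + \<beta>) \<Longrightarrow> cauchy_product a b \<gamma> = 0"
proof -
  have zero: "a \<alpha>' * b \<beta>' = 0"
    if "lex_less (\<alpha>' + \<beta>') (\<alpha> + \<beta>) \<or> \<alpha>' + \<beta>' = \<alpha> + \<beta> \<and> \<alpha>' \<noteq> \<alpha>" for \<alpha>' \<beta>' :: "nat ^ 'n::{finite,linorder}"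
  proof (rule ccontr)
    assume "a \<alpha>' * b \<beta>' \<noteq> 0"
    then have "\<not> lex_less \<alpha>' \<alpha>" "\<not> lex_less \<beta>' \<beta>" using a b by auto
    then have *: "\<alpha> = \<alpha>' \<or> lex_less \<alpha> \<alpha>'" "\<beta> = \<beta>' \<or> lex_less \<beta> \<beta>'"
      using lex_less_trichotomy by blast+
    have irrefl: "\<not> (lex_less \<gamma> \<delta> \<and> (lex_less \<delta> \<gamma> \<or> \<delta> = \<gamma>))" for \<gamma> \<delta> :: "nat ^ 'n::{finite,linorder}"
      using less_fun_asym unfolding lex_less_def by blast
    have "lex_less (\<alpha> + \<beta>) (\<alpha>' + \<beta>') \<or> \<alpha> = \<alpha>' \<and> \<beta> = \<beta>'"
      using * lex_less_add_mono[of \<alpha> \<alpha>' \<beta> \<beta>'] lex_less_add_mono[of \<beta> \<beta>' \<alpha> \<alpha>'] by (auto simp: add.commute)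
    then show False using that irrefl by metis
  qed
  have sub: "\<alpha>' + (\<gamma> - \<alpha>') = \<gamma>" if "\<forall>l. \<alpha>' $ l \<le> \<gamma> $ l" for \<alpha>' \<gamma> :: "nat ^ 'n::{finite,linorder}"
    using that by (auto simp: vec_eq_iff)
  show "cauchy_product a b \<gamma> = 0" if "lex_less \<gamma> (\<alpha> + \<beta>)"
    unfolding cauchy_product_def using zero sub that by (intro sum.neutral) auto
  have "cauchy_product a b (\<alpha> + \<beta>) = (\<Sum>\<alpha>'\<in>{\<alpha>}. a \<alpha>' * b (\<alpha> + \<beta> - \<alpha>'))"
    unfolding cauchy_product_def
  proof (rule sum.mono_neutral_right[OF finite_smaller_multi_indices])
    show "\<forall>\<alpha>'\<in>{\<alpha>'. \<forall>l. \<alpha>' $ l \<le> (\<alpha> + \<beta>) $ l} - {\<alpha>}. a \<alpha>' * b (\<alpha> + \<beta> - \<alpha>') = 0"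
      using zero sub by blast
  qed auto
  also have "\<dots> = a \<alpha> * b \<beta>"
  proof -
    have "\<alpha> + \<beta> - \<alpha> = \<beta>" by (simp add: vec_eq_iff)
    then show ?thesis by simp
  qed
  finally show "cauchy_product a b (\<alpha> + \<beta>) = a \<alpha> * b \<beta>" .
qed

section \<open>Sections and their norms\<close>

lemma holomorphic_cn_subset: "holomorphic_cn f S \<Longrightarrow> T \<subseteq> S \<Longrightarrow> holomorphic_cn f T"
  by (auto simp: holomorphic_cn_def)

lemma holomorphic_cn_mult:
  assumes "holomorphic_cn f S" "holomorphic_cn g S"
  shows "holomorphic_cn (\<lambda>z. f z * g z) S"
  unfolding holomorphic_cn_def
proof
  fix z assume z: "z \<in> S"
  obtain D D' where D: "(f has_derivative D) (at z)" "\<And>c v. D (c *s v) = c * D v"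
    and D': "(g has_derivative D') (at z)" "\<And>c v. D' (c *s v) = c * D' v"
    using assms z unfolding holomorphic_cn_def by blast
  have "((\<lambda>z. f z * g z) has_derivative (\<lambda>v. f z * D' v + D v * g z)) (at z)"
    using D(1) D'(1) by (rule has_derivative_mult)
  then show "\<exists>D. ((\<lambda>z. f z * g z) has_derivative D) (at z) \<and> (\<forall>c v. D (c *s v) = c * D v)"
    using D(2) D'(2) by (intro exI[of _ "\<lambda>v. f z * D' v + D v * g z"]) (simp add: algebra_simps)
qed

lemma holomorphic_cn_const: "holomorphic_cn (\<lambda>z. c) S"
  unfolding holomorphic_cn_def by (intro ballI exI[of _ "\<lambda>v. 0"]) simp

lemma holomorphic_cn_power:
  "holomorphic_cn f S \<Longrightarrow> holomorphic_cn (\<lambda>z. f z ^ k) S"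
  by (induction k) (simp_all add: holomorphic_cn_const holomorphic_cn_mult)

lemma holomorphic_cn_inverse:
  assumes "holomorphic_cn f S" "\<And>z. z \<in> S \<Longrightarrow> f z \<noteq> 0"
  shows "holomorphic_cn (\<lambda>z. inverse (f z)) S"
  unfolding holomorphic_cn_def
proof
  fix z assume z: "z \<in> S"
  obtain D where D: "(f has_derivative D) (at z)" "\<And>c v. D (c *s v) = c * D v"
    using assms z unfolding holomorphic_cn_def by blast
  have "((\<lambda>z. inverse (f z)) has_derivative (\<lambda>v. - (inverse (f z) * D v * inverse (f z)))) (at z)"
    by (rule Deriv.has_derivative_inverse[OF assms(2)[OF z] D(1)])
  then show "\<exists>D. ((\<lambda>z. inverse (f z)) has_derivative D) (at z) \<and> (\<forall>c v. D (c *s v) = c * D v)"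
    using D(2) by (intro exI[of _ "\<lambda>v. - (inverse (f z) * D v * inverse (f z))"]) simp
qed

lemma holomorphic_cn_continuous_on:
  assumes "holomorphic_cn f S"
  shows "continuous_on S f"
proof (rule continuous_at_imp_continuous_on, rule ballI)
  fix z assume "z \<in> S"
  then obtain D where "(f has_derivative D) (at z)"
    using assms unfolding holomorphic_cn_def by blast
  then show "isCont f z" by (rule has_derivative_continuous)
qed

lemma has_derivative_vec:
  fixes f :: "complex ^ 'm::finite \<Rightarrow> complex ^ 'n::finite"
  assumes "\<And>j. ((\<lambda>z. f z $ j) has_derivative (\<lambda>v. D v $ j)) (at z)"
  shows "(f has_derivative D) (at z)"
proof (rule has_derivative_componentwise_within[THEN iffD2], rule ballI)
  fix i :: "complex ^ 'n" assume "i \<in> Basis"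
  then obtain l u where i: "i = axis l u"
    unfolding Basis_vec_def by blast
  have "((\<lambda>z. (f z $ l) \<bullet> u) has_derivative (\<lambda>v. (D v $ l) \<bullet> u)) (at z)"
    using assms by (rule has_derivative_inner_left)
  then show "((\<lambda>z. f z \<bullet> i) has_derivative (\<lambda>v. D v \<bullet> i)) (at z)"
    by (simp add: i inner_axis)
qed

lemma holomorphic_funD:
  "holomorphic_fun X f S \<Longrightarrow> (U, \<phi>) \<in> charts X \<Longrightarrow>
     holomorphic_cn (\<lambda>z. f (inv_into U \<phi> z)) (\<phi> ` (S \<inter> U))"
  unfolding holomorphic_fun_def by (drule (1) bspec) simp

lemma is_chart_charts:
  assumes "compact_complex_manifold X" "(U, \<phi>) \<in> charts X"
  shows "is_chart (points X) U \<phi>"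
proof -
  have "\<forall>(U, \<phi>)\<in>charts X. is_chart (points X) U \<phi>"
    using assms(1) unfolding compact_complex_manifold_def by blast
  from bspec[OF this assms(2)] show ?thesis by simp
qed

lemma holomorphic_fun_mult:
  "holomorphic_fun X f S \<Longrightarrow> holomorphic_fun X g S \<Longrightarrow> holomorphic_fun X (\<lambda>x. f x * g x) S"
  unfolding holomorphic_fun_def by (auto intro: holomorphic_cn_mult)

lemma holomorphic_fun_const: "holomorphic_fun X (\<lambda>x. c) S"
  unfolding holomorphic_fun_def by (auto intro: holomorphic_cn_const)

lemma H0_mult:
  assumes "s \<in> H0 X L k" "t \<in> H0 X L m"
  shows "s * t \<in> H0 X L (k + m)"
proof -
  have "holomorphic_fun X ((s * t) i) (triv_dom L i)" if "i \<in> indices L" for i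
    using holomorphic_fun_mult[of X "s i" "triv_dom L i" "t i"] assms that
    by (simp add: H0_def times_fun_def)
  moreover have "(s * t) i x = transition L i j x ^ (k + m) * (s * t) j x"
    if "i \<in> indices L" "j \<in> indices L" "x \<in> triv_dom L i \<inter> triv_dom L j" for i j x
  proof -
    have "s i x = transition L i j x ^ k * s j x" "t i x = transition L i j x ^ m * t j x"
      using assms that unfolding H0_def by blast+
    then show ?thesis by (simp only: times_fun_apply power_add mult_ac)
  qed
  moreover have "(s * t) i x = 0" if "\<not> (i \<in> indices L \<and> x \<in> triv_dom L i)" for i x
    using assms that unfolding H0_def times_fun_apply by simp
  ultimately show ?thesis unfolding H0_def by blast
qed

lemma H0_scale:
  assumes "s \<in> H0 X L k"
  shows "section_scale c s \<in> H0 X L k"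
proof -
  have "holomorphic_fun X (section_scale c s i) (triv_dom L i)" if "i \<in> indices L" for i
    using holomorphic_fun_mult[OF holomorphic_fun_const, of X "s i" "triv_dom L i" c] assms that
    by (simp add: H0_def section_scale_def)
  moreover have "section_scale c s i x = transition L i j x ^ k * section_scale c s j x"
    if "i \<in> indices L" "j \<in> indices L" "x \<in> triv_dom L i \<inter> triv_dom L j" for i j x
  proof -
    have "s i x = transition L i j x ^ k * s j x"
      using assms that unfolding H0_def by blast
    then show ?thesis by (simp only: section_scale_def mult_ac)
  qed
  moreover have "section_scale c s i x = 0" if "\<not> (i \<in> indices L \<and> x \<in> triv_dom L i)" for i x
    using assms that unfolding H0_def section_scale_def by simp
  ultimately show ?thesis unfolding H0_def by blast
qed

lemma has_expansion_mult:
  assumes "has_expansion L E k s a" "has_expansion L E m t b"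
  shows "has_expansion L E (k + m) (s * t) (cauchy_product a b)"
proof -
  obtain r where r: "r > 0" "\<And>x i. x \<in> nbhd E \<Longrightarrow> \<forall>l. cmod (coord E x $ l) < r \<Longrightarrow> i \<in> indices L \<Longrightarrow> x \<in> triv_dom L i \<Longrightarrow>
      ((\<lambda>\<alpha>. a \<alpha> * monomial (coord E x) \<alpha>) has_sum (s i x / frame E i x ^ k)) UNIV"
    using assms(1) unfolding has_expansion_def by blast
  obtain r' where r': "r' > 0" "\<And>x i. x \<in> nbhd E \<Longrightarrow> \<forall>l. cmod (coord E x $ l) < r' \<Longrightarrow> i \<in> indices L \<Longrightarrow> x \<in> triv_dom L i \<Longrightarrow>
      ((\<lambda>\<alpha>. b \<alpha> * monomial (coord E x) \<alpha>) has_sum (t i x / frame E i x ^ m)) UNIV"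
    using assms(2) unfolding has_expansion_def by blast
  show ?thesis unfolding has_expansion_def
  proof (intro exI[of _ "min r r'"] conjI ballI impI)
    show "0 < min r r'" using r r' by simp
    fix x i assume x: "x \<in> nbhd E" "\<forall>l. cmod (coord E x $ l) < min r r'" "i \<in> indices L" "x \<in> triv_dom L i"
    have "((\<lambda>\<gamma>. cauchy_product a b \<gamma> * monomial (coord E x) \<gamma>) has_sum
        (s i x / frame E i x ^ k) * (t i x / frame E i x ^ m)) UNIV"
      using x by (intro has_sum_cauchy_product r(2) r'(2)) auto
    then show "((\<lambda>\<gamma>. cauchy_product a b \<gamma> * monomial (coord E x) \<gamma>) has_sum
        ((s * t) i x / frame E i x ^ (k + m))) UNIV"
      by (simp add: times_fun_apply power_add)
  qed
qed

lemma has_lowest_term_mult: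
  assumes "has_lowest_term L E k s c \<alpha>" "has_lowest_term L E m t d \<beta>"
  shows "has_lowest_term L E (k + m) (s * t) (c * d) (\<alpha> + \<beta>)"
proof -
  obtain a b where ab: "has_expansion L E k s a" "a \<alpha> = c" "\<And>\<gamma>. lex_less \<gamma> \<alpha> \<Longrightarrow> a \<gamma> = 0"
      "has_expansion L E m t b" "b \<beta> = d" "\<And>\<gamma>. lex_less \<gamma> \<beta> \<Longrightarrow> b \<gamma> = 0"
    using assms unfolding has_lowest_term_def by blast
  show ?thesis unfolding has_lowest_term_def
    using has_expansion_mult[OF ab(1,4)] cauchy_product_lowest[of \<alpha> a \<beta> b] ab by blast
qed

lemma has_lowest_term_scale:
  assumes "has_lowest_term L E k s c \<alpha>"
  shows "has_lowest_term L E k (section_scale d s) (d * c) \<alpha>"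
proof -
  obtain a where a: "has_expansion L E k s a" "a \<alpha> = c" "\<And>\<gamma>. lex_less \<gamma> \<alpha> \<Longrightarrow> a \<gamma> = 0"
    using assms unfolding has_lowest_term_def by blast
  obtain r where r: "r > 0" "\<And>x i. x \<in> nbhd E \<Longrightarrow> \<forall>l. cmod (coord E x $ l) < r \<Longrightarrow> i \<in> indices L \<Longrightarrow> x \<in> triv_dom L i \<Longrightarrow>
      ((\<lambda>\<alpha>. a \<alpha> * monomial (coord E x) \<alpha>) has_sum (s i x / frame E i x ^ k)) UNIV"
    using a(1) unfolding has_expansion_def by blast
  have "has_expansion L E k (section_scale d s) (\<lambda>\<alpha>. d * a \<alpha>)"
    unfolding has_expansion_def
  proof (intro exI[of _ r] conjI ballI impI)
    fix x i assume "x \<in> nbhd E" "\<forall>l. cmod (coord E x $ l) < r" "i \<in> indices L" "x \<in> triv_dom L i"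
    from has_sum_cmult_right[OF r(2)[OF this], of d]
    show "((\<lambda>\<alpha>. d * a \<alpha> * monomial (coord E x) \<alpha>) has_sum (section_scale d s i x / frame E i x ^ k)) UNIV"
      by (simp add: section_scale_def mult.assoc)
  qed (rule r(1))
  then show ?thesis unfolding has_lowest_term_def using a by (intro exI[of _ "\<lambda>\<alpha>. d * a \<alpha>"]) auto
qed

definition pointwise_norm2 ::
  "('i \<Rightarrow> 'x \<Rightarrow> real) \<Rightarrow> nat \<Rightarrow> ('i \<Rightarrow> 'x \<Rightarrow> complex) \<Rightarrow> 'i \<Rightarrow> 'x \<Rightarrow> real" where
  "pointwise_norm2 \<psi> k s i x = (cmod (s i x))\<^sup>2 * exp (- (real k * \<psi> i x))"

lemma pointwise_norm2_nonneg: "0 \<le> pointwise_norm2 \<psi> k s i x"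
  by (simp add: pointwise_norm2_def)

lemma pointwise_norm2_mult:
  "pointwise_norm2 \<psi> (k + m) (s * t) i x = pointwise_norm2 \<psi> k s i x * pointwise_norm2 \<psi> m t i x"
proof -
  have "exp (- (real (k + m) * \<psi> i x)) = exp (- (real k * \<psi> i x)) * exp (- (real m * \<psi> i x))"
    by (simp add: distrib_right flip: exp_add)
  then show ?thesis
    by (simp add: pointwise_norm2_def norm_mult power_mult_distrib)
qed

text \<open>The factor \<open>|g|\<^sup>2\<^sup>k\<close> from the transition function of \<open>kL\<close> cancels against the transformation rule of
  the metric.\<close>

lemma pointwise_norm2_independent:
  assumes L: "line_bundle X L" and \<psi>: "continuous_metric L \<psi>" and s: "s \<in> H0 X L k"
    and i: "i \<in> indices L" "x \<in> triv_dom L i" and j: "j \<in> indices L" "x \<in> triv_dom L j"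
  shows "pointwise_norm2 \<psi> k s i x = pointwise_norm2 \<psi> k s j x"
proof -
  define g where "g = transition L i j x"
  have g: "g \<noteq> 0" using L i j unfolding line_bundle_def g_def by blast
  have s_eq: "s i x = g ^ k * s j x" using s i j unfolding H0_def g_def by blast
  have "\<psi> i x = \<psi> j x + ln ((cmod g)\<^sup>2)" using \<psi> i j unfolding continuous_metric_def g_def by blast
  then have "exp (- (real k * \<psi> i x)) = exp (- (real k * \<psi> j x)) * exp (- (real k * ln ((cmod g)\<^sup>2)))"
    by (simp add: distrib_left flip: exp_add)
  also have "exp (- (real k * ln ((cmod g)\<^sup>2))) = inverse (((cmod g)\<^sup>2) ^ k)"
    using g by (simp add: exp_minus exp_of_nat_mult)
  finally show ?thesis
    using g by (simp add: pointwise_norm2_def s_eq norm_mult norm_power power_mult_distrib mult.commute flip: power_mult)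
qed

lemma at_within_openin:
  assumes "openin (top_of_set P) U" "x \<in> U"
  shows "at x within P = at x within U"
proof -
  obtain T where T: "open T" "U = P \<inter> T" using assms(1) by (auto simp: openin_open)
  then show ?thesis using assms(2) by (intro at_within_nhd[of x T]) auto
qed

lemma chart_inverse:
  assumes "is_chart P U \<phi>"
  shows "x \<in> U \<Longrightarrow> inv_into U \<phi> (\<phi> x) = x" and "continuous_on U \<phi>"
    and "continuous_on (\<phi> ` U) (inv_into U \<phi>)"
    and "openin (top_of_set P) S \<Longrightarrow> open (\<phi> ` (U \<inter> S))"
proof -
  obtain g where g: "homeomorphism U (\<phi> ` U) \<phi> g" and o: "open (\<phi> ` U)" "openin (top_of_set P) U"
    using assms unfolding is_chart_def by blast
  have inj: "inj_on \<phi> U" using homeomorphism_apply1[OF g] by (rule inj_on_inverseI)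
  show inv: "inv_into U \<phi> (\<phi> x) = x" if "x \<in> U" for x
    using inj that by (rule inv_into_f_f)
  show "continuous_on U \<phi>" using g by (simp add: homeomorphism_def)
  have "continuous_on (\<phi> ` U) g" using g by (simp add: homeomorphism_def)
  moreover have "g z = inv_into U \<phi> z" if "z \<in> \<phi> ` U" for z
  proof -
    obtain x where x: "x \<in> U" "z = \<phi> x" using \<open>z \<in> \<phi> ` U\<close> by blast
    then have "g z = x" using homeomorphism_apply1[OF g] by simp
    then show ?thesis using x inv by simp
  qed
  ultimately show "continuous_on (\<phi> ` U) (inv_into U \<phi>)"
    by (rule continuous_on_cong[THEN iffD1, OF refl, rotated])
  assume S: "openin (top_of_set P) S"
  then have "openin (top_of_set U) (U \<inter> S)"
    using openin_imp_subset[OF o(2)] by (intro openin_subset_trans[OF openin_Int[OF o(2) S]]) auto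
  then have "openin (top_of_set (\<phi> ` U)) (\<phi> ` (U \<inter> S))"
    by (rule homeomorphism_imp_open_map[OF g])
  then show "open (\<phi> ` (U \<inter> S))" using o(1) openin_open_eq by blast
qed

lemma holomorphic_fun_continuous_on:
  assumes X: "compact_complex_manifold X" and S: "openin (top_of_set (points X)) S"
    and f: "holomorphic_fun X f S"
  shows "continuous_on S f"
  unfolding continuous_on_eq_continuous_within
proof
  fix x assume x: "x \<in> S"
  then have "x \<in> points X" using openin_imp_subset[OF S] by blast
  then have "x \<in> \<Union> (fst ` charts X)"
    using X unfolding compact_complex_manifold_def by blast
  then obtain U \<phi> where U: "(U, \<phi>) \<in> charts X" "x \<in> U"
    by auto
  have ch: "is_chart (points X) U \<phi>" by (rule is_chart_charts[OF X U(1)])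
  then have oU: "openin (top_of_set (points X)) U" unfolding is_chart_def by blast
  have "continuous_on (\<phi> ` (S \<inter> U)) (\<lambda>z. f (inv_into U \<phi> z))"
    by (rule holomorphic_cn_continuous_on[OF holomorphic_funD[OF f U(1)]])
  moreover have "continuous_on (S \<inter> U) \<phi>"
    using chart_inverse(2)[OF ch] by (rule continuous_on_subset) auto
  ultimately have "continuous_on (S \<inter> U) (\<lambda>y. f (inv_into U \<phi> (\<phi> y)))"
    by (rule continuous_on_compose2) auto
  then have "continuous_on (S \<inter> U) f"
    by (rule continuous_on_cong[THEN iffD1, rotated 2]) (auto simp: chart_inverse(1)[OF ch])
  then have "continuous (at x within S \<inter> U) f"
    using x U(2) unfolding continuous_on_eq_continuous_within by blast
  moreover have "at x within S \<inter> U = at x within S"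
    using at_within_openin[OF openin_Int[OF S oU]] at_within_openin[OF S] x U(2) by simp
  ultimately show "continuous (at x within S) f" by simp
qed

text \<open>The pointwise norm is a well-defined continuous function on a compact space.  Without this bound the
  supremum in \<open>sup_norm2\<close> would carry no information.\<close>

lemma pointwise_norm2_bounded:
  assumes X: "compact_complex_manifold X" and L: "line_bundle X L"
    and \<psi>: "continuous_metric L \<psi>" and s: "s \<in> H0 X L k"
  shows "bdd_above {pointwise_norm2 \<psi> k s i x | i x. i \<in> indices L \<and> x \<in> triv_dom L i}"
proof -
  \<comment> \<open>A choice of trivialization at each point turns the pointwise norm into one function on \<open>X\<close>.\<close>
  define \<iota> where "\<iota> x = (SOME i. i \<in> indices L \<and> x \<in> triv_dom L i)" for x
  define n where "n x = pointwise_norm2 \<psi> k s (\<iota> x) x" for x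
  have \<iota>: "\<iota> x \<in> indices L \<and> x \<in> triv_dom L (\<iota> x)" if "i \<in> indices L" "x \<in> triv_dom L i" for i x
    unfolding \<iota>_def by (rule someI[of "\<lambda>i. i \<in> indices L \<and> x \<in> triv_dom L i" i]) (use that in simp)
  have n: "n x = pointwise_norm2 \<psi> k s i x" if "i \<in> indices L" "x \<in> triv_dom L i" for i x
    unfolding n_def using \<iota>[OF that] that by (intro pointwise_norm2_independent[OF L \<psi> s]) auto
  have sub: "triv_dom L i \<subseteq> points X" if "i \<in> indices L" for i
    using L that unfolding line_bundle_def by blast
  have "continuous_on (points X) n"
    unfolding continuous_on_eq_continuous_within
  proof
    fix x assume "x \<in> points X"
    then obtain i where i: "i \<in> indices L" "x \<in> triv_dom L i"
      using L unfolding line_bundle_def by blast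
    have o: "openin (top_of_set (points X)) (triv_dom L i)"
      using L i unfolding line_bundle_def by blast
    have "holomorphic_fun X (s i) (triv_dom L i)" using s i unfolding H0_def by blast
    from holomorphic_fun_continuous_on[OF X o this]
    have c: "continuous_on (triv_dom L i) (s i)" "continuous_on (triv_dom L i) (\<psi> i)"
      using \<psi> i(1) unfolding continuous_metric_def by blast+
    have "continuous_on (triv_dom L i) (\<lambda>x. pointwise_norm2 \<psi> k s i x)"
      unfolding pointwise_norm2_def by (intro continuous_intros c)
    then have "continuous_on (triv_dom L i) n"
      by (rule continuous_on_cong[THEN iffD1, rotated 2]) (simp_all add: n[OF i(1)])
    then show "continuous (at x within points X) n"
      using i at_within_openin[OF o] unfolding continuous_on_eq_continuous_within by simp
  qed
  moreover have "compact (points X)" using X unfolding compact_complex_manifold_def by blast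
  ultimately have "bdd_above (n ` points X)"
    by (intro bounded_imp_bdd_above compact_imp_bounded compact_continuous_image)
  moreover have "{pointwise_norm2 \<psi> k s i x | i x. i \<in> indices L \<and> x \<in> triv_dom L i} \<subseteq> n ` points X"
  proof
    fix y assume "y \<in> {pointwise_norm2 \<psi> k s i x | i x. i \<in> indices L \<and> x \<in> triv_dom L i}"
    then obtain i x where ix: "i \<in> indices L" "x \<in> triv_dom L i" "y = pointwise_norm2 \<psi> k s i x" by blast
    then have "y = n x" by (simp add: n)
    then show "y \<in> n ` points X" using sub[OF ix(1)] ix(2) by blast
  qed
  ultimately show ?thesis by (rule bdd_above_mono)
qed

lemma sup_norm2_altdef:
  "sup_norm2 L \<psi> k s = Sup {pointwise_norm2 \<psi> k s i x | i x. i \<in> indices L \<and> x \<in> triv_dom L i}"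
  by (simp add: sup_norm2_def pointwise_norm2_def)

lemma pointwise_norm2_le_sup_norm2:
  assumes "compact_complex_manifold X" "line_bundle X L" "continuous_metric L \<psi>" "s \<in> H0 X L k"
    and "i \<in> indices L" "x \<in> triv_dom L i"
  shows "pointwise_norm2 \<psi> k s i x \<le> sup_norm2 L \<psi> k s"
  unfolding sup_norm2_altdef
  by (rule cSup_upper[OF _ pointwise_norm2_bounded[OF assms(1-4)]]) (use assms in blast)

lemma sup_norm2_mult:
  assumes X: "compact_complex_manifold X" "line_bundle X L" "continuous_metric L \<psi>"
    and s: "s \<in> H0 X L k" and t: "t \<in> H0 X L m" and ne: "points X \<noteq> {}"
  shows "sup_norm2 L \<psi> (k + m) (s * t) \<le> sup_norm2 L \<psi> k s * sup_norm2 L \<psi> m t"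
  unfolding sup_norm2_altdef[of L \<psi> "k + m"]
proof (rule cSup_least)
  show "{pointwise_norm2 \<psi> (k + m) (s * t) i x | i x. i \<in> indices L \<and> x \<in> triv_dom L i} \<noteq> {}"
    using X(2) ne unfolding line_bundle_def by blast
  fix y assume "y \<in> {pointwise_norm2 \<psi> (k + m) (s * t) i x | i x. i \<in> indices L \<and> x \<in> triv_dom L i}"
  then obtain i x where y: "y = pointwise_norm2 \<psi> (k + m) (s * t) i x" and ix: "i \<in> indices L" "x \<in> triv_dom L i"
    by blast
  show "y \<le> sup_norm2 L \<psi> k s * sup_norm2 L \<psi> m t"
    unfolding y pointwise_norm2_mult
    by (rule mult_mono'[OF pointwise_norm2_le_sup_norm2[OF X s ix] pointwise_norm2_le_sup_norm2[OF X t ix]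
          pointwise_norm2_nonneg pointwise_norm2_nonneg])
qed

text \<open>Holomorphy is tested in the charts of the atlas; the chain rule with the transition map transports it
  to the given local coordinates, which need not belong to the atlas.\<close>

lemma holomorphic_fun_in_coordinates:
  fixes X :: "('x::t2_space, 'n::{finite,linorder}) cspace"
  assumes X: "compact_complex_manifold X" and E: "local_data_at X L x0 E"
    and u: "holomorphic_fun X u S"
  shows "holomorphic_cn (\<lambda>z. u (inv_into (nbhd E) (coord E) z)) (coord E ` (nbhd E \<inter> S))"
  unfolding holomorphic_cn_def
proof
  define \<iota> where "\<iota> = inv_into (nbhd E) (coord E)"
  have ch: "is_chart (points X) (nbhd E) (coord E)"
    using E unfolding local_data_at_def by blast
  fix z assume "z \<in> coord E ` (nbhd E \<inter> S)"
  then obtain y where y: "z = coord E y" "y \<in> nbhd E" "y \<in> S" by blast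
  have \<iota>z: "\<iota> z = y" unfolding y(1) \<iota>_def by (rule chart_inverse(1)[OF ch y(2)])
  have "y \<in> points X"
    using ch y(2) openin_imp_subset unfolding is_chart_def by blast
  then have "y \<in> \<Union> (fst ` charts X)"
    using X unfolding compact_complex_manifold_def by blast
  then obtain U \<phi> where U: "(U, \<phi>) \<in> charts X" "y \<in> U"
    by auto
  have chU: "is_chart (points X) U \<phi>" by (rule is_chart_charts[OF X U(1)])
  then have "openin (top_of_set (points X)) U" unfolding is_chart_def by blast
  then have o: "open (coord E ` (nbhd E \<inter> U))" by (rule chart_inverse(4)[OF ch])
  have zo: "z \<in> coord E ` (nbhd E \<inter> U)" using y U by blast
  have "\<forall>(U, \<phi>)\<in>charts X. holomorphic_transition U \<phi> (nbhd E) (coord E) \<and>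
                        holomorphic_transition (nbhd E) (coord E) U \<phi>"
    using E unfolding local_data_at_def by blast
  from bspec[OF this U(1)] have "holomorphic_transition (nbhd E) (coord E) U \<phi>" by simp
  then have "\<forall>j. \<exists>D. ((\<lambda>z. \<phi> (\<iota> z) $ j) has_derivative D) (at z) \<and> (\<forall>c v. D (c *s v) = c * D v)"
    using zo unfolding holomorphic_transition_def holomorphic_cn_def \<iota>_def by blast
  then obtain T where T: "\<And>j. ((\<lambda>z. \<phi> (\<iota> z) $ j) has_derivative T j) (at z)" "\<And>j c v. T j (c *s v) = c * T j v"
    by metis
  have T': "((\<lambda>z. \<phi> (\<iota> z)) has_derivative (\<lambda>v. \<chi> j. T j v)) (at z)"
    by (rule has_derivative_vec) (simp add: T(1))
  have "\<phi> y \<in> \<phi> ` (S \<inter> U)" using y U by blast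
  then obtain D where D: "((\<lambda>w. u (inv_into U \<phi> w)) has_derivative D) (at (\<phi> (\<iota> z)))" "\<And>c v. D (c *s v) = c * D v"
    using holomorphic_funD[OF u U(1)] unfolding holomorphic_cn_def \<iota>z by blast
  have "((\<lambda>z. u (inv_into U \<phi> (\<phi> (\<iota> z)))) has_derivative (\<lambda>v. D (\<chi> j. T j v))) (at z)"
    using has_derivative_compose[OF T' D(1)] .
  then have "((\<lambda>z. u (\<iota> z)) has_derivative (\<lambda>v. D (\<chi> j. T j v))) (at z)"
  proof (rule has_derivative_transform_within_open[OF _ o zo])
    fix w assume "w \<in> coord E ` (nbhd E \<inter> U)"
    then obtain x where x: "w = coord E x" "x \<in> nbhd E" "x \<in> U" by blast
    have "\<iota> w = x" unfolding x(1) \<iota>_def by (rule chart_inverse(1)[OF ch x(2)])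
    then show "u (inv_into U \<phi> (\<phi> (\<iota> w))) = u (\<iota> w)"
      by (simp add: chart_inverse(1)[OF chU x(3)])
  qed
  moreover have "D (\<chi> j. T j (c *s v)) = c * D (\<chi> j. T j v)" for c v
  proof -
    have "(\<chi> j. T j (c *s v)) = c *s (\<chi> j. T j v)" by (simp add: vec_eq_iff T(2))
    then show ?thesis by (simp only: D(2))
  qed
  ultimately show "\<exists>D. ((\<lambda>z. u (inv_into (nbhd E) (coord E) z)) has_derivative D) (at z) \<and> (\<forall>c v. D (c *s v) = c * D v)"
    unfolding \<iota>_def by blast
qed

lemma polydisc_subset_ball:
  fixes z :: "complex ^ 'n::finite"
  assumes "\<And>l. cmod (z $ l) < e / CARD('n)" "0 < e"
  shows "z \<in> cball 0 e"
proof -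
  have "norm z \<le> (\<Sum>l\<in>UNIV. cmod (z $ l))"
    unfolding norm_vec_def by (rule L2_set_le_sum) simp
  also have "\<dots> \<le> (\<Sum>l\<in>(UNIV::'n set). e / CARD('n))"
    using assms(1) by (intro sum_mono less_imp_le)
  also have "\<dots> = e" by simp
  finally show ?thesis by simp
qed

text \<open>On a fixed polydisc \<open>\<psi>\<close> and the logarithm of \<open>|e|\<close> in the frame of the bundle are bounded,
  so \<open>|s/e\<^sup>k|\<^sup>2\<close> exceeds the squared norm of \<open>s\<close> by a factor of at most \<open>exp (k B)\<close>; the estimate of the lowest coefficient, which is \<open>1\<close>, gives \<open>r\<^sup>2\<^sup>|\<^sup>\<alpha>\<^sup>| \<le> \<parallel>s\<parallel>\<^sup>2 exp (k B)\<close>.\<close>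

theorem ln_sup_norm2_lower_bound:
  fixes X :: "('x::t2_space, 'n::{finite,linorder}) cspace"
  assumes X: "compact_complex_manifold X" and L: "line_bundle X L" and \<psi>: "continuous_metric L \<psi>"
    and x0: "x0 \<in> points X" and E: "local_data_at X L x0 E"
  obtains C where "0 \<le> C"
    "\<And>k s \<alpha>. s \<in> H0 X L k \<Longrightarrow> has_lowest_term L E k s 1 \<alpha> \<Longrightarrow>
       0 < sup_norm2 L \<psi> k s \<and> - C * (real k + (\<Sum>l\<in>UNIV. real (\<alpha> $ l))) \<le> ln (sup_norm2 L \<psi> k s)"
proof -
  define \<iota> where "\<iota> = inv_into (nbhd E) (coord E)"
  have ch: "is_chart (points X) (nbhd E) (coord E)" and x0E: "x0 \<in> nbhd E" "coord E x0 = 0"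
    using E unfolding local_data_at_def by blast+
  obtain i where i: "i \<in> indices L" "x0 \<in> triv_dom L i"
    using L x0 unfolding line_bundle_def by blast
  have o: "openin (top_of_set (points X)) (triv_dom L i)"
    using L i unfolding line_bundle_def by blast
  define N where "N = nbhd E \<inter> triv_dom L i"
  define P where "P = coord E ` N"
  have P: "open P" "0 \<in> P"
    using chart_inverse(4)[OF ch o] i x0E by (auto simp: P_def N_def image_iff intro!: bexI[of _ x0])
  then obtain e where e: "0 < e" "cball 0 e \<subseteq> P"
    by (meson open_contains_cball)
  have \<iota>: "\<iota> z \<in> N" "coord E (\<iota> z) = z" if "z \<in> P" for z
    using that chart_inverse(1)[OF ch] unfolding P_def N_def \<iota>_def by auto
  define fr where "fr z = frame E i (\<iota> z)" for z
  have fr_hol: "holomorphic_cn fr P"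
  proof -
    have "holomorphic_fun X (frame E i) (nbhd E \<inter> triv_dom L i)"
      using E i unfolding local_data_at_def by blast
    from holomorphic_fun_in_coordinates[OF X E this] show ?thesis
      unfolding fr_def[abs_def] \<iota>_def P_def N_def by simp
  qed
  have fr0: "fr z \<noteq> 0" if "z \<in> P" for z
    using E i \<iota>[OF that] unfolding local_data_at_def fr_def N_def by blast
  have cont: "continuous_on P (\<lambda>z. \<psi> i (\<iota> z) - 2 * ln (cmod (fr z)))"
  proof -
    have "continuous_on P \<iota>"
      unfolding \<iota>_def P_def by (rule continuous_on_subset[OF chart_inverse(3)[OF ch]]) (auto simp: N_def)
    moreover have "continuous_on (triv_dom L i) (\<psi> i)"
      using \<psi> i unfolding continuous_metric_def by blast
    ultimately have "continuous_on P (\<lambda>z. \<psi> i (\<iota> z))"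
      using \<iota> by (intro continuous_on_compose2[of "triv_dom L i" "\<psi> i" P \<iota>]) (auto simp: N_def)
    then show ?thesis
      using holomorphic_cn_continuous_on[OF fr_hol] fr0 by (intro continuous_intros) auto
  qed
  have "bounded ((\<lambda>z. \<psi> i (\<iota> z) - 2 * ln (cmod (fr z))) ` cball 0 e)"
    by (intro compact_imp_bounded compact_continuous_image continuous_on_subset[OF cont e(2)]) simp
  then obtain B where "\<forall>y\<in>(\<lambda>z. \<psi> i (\<iota> z) - 2 * ln (cmod (fr z))) ` cball 0 e. norm y \<le> B"
    unfolding bounded_iff by blast
  then have B: "\<bar>\<psi> i (\<iota> z) - 2 * ln (cmod (fr z))\<bar> \<le> B" if "z \<in> cball 0 e" for z
    using that by (simp only: real_norm_def ball_simps)
  have B0: "0 \<le> B" using B[of 0] e by force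
  \<comment> \<open>The polydisc of radius \<open>R\<close> lies in the ball of radius \<open>e\<close>, by the 1-norm.\<close>
  define R where "R = e / CARD('n::{finite,linorder})"
  have R: "0 < R" using e by (simp add: R_def)
  have poly: "{z :: complex ^ 'n::{finite,linorder}. \<forall>l. cmod (z $ l) < R} \<subseteq> cball 0 e"
    using polydisc_subset_ball e(1) unfolding R_def by blast
  define r where "r = R / 2"
  have r: "0 < r" "r < R" using R by (auto simp: r_def)
  define C where "C = B + 2 * \<bar>ln r\<bar>"
  show ?thesis
  proof (rule that[of C])
    show "0 \<le> C" using B0 by (simp add: C_def)
    fix k s and \<alpha> :: "nat ^ 'n::{finite,linorder}"
    assume s: "s \<in> H0 X L k" and low: "has_lowest_term L E k s 1 \<alpha>"
    define S where "S = sup_norm2 L \<psi> k s"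
    define A where "A = (\<Sum>l\<in>UNIV. \<alpha> $ l)"
    obtain a where a: "has_expansion L E k s a" "a \<alpha> = 1" "\<And>\<beta>. lex_less \<beta> \<alpha> \<Longrightarrow> a \<beta> = 0"
      using low unfolding has_lowest_term_def by blast
    obtain \<rho> where \<rho>: "0 < \<rho>" "\<And>x i. x \<in> nbhd E \<Longrightarrow> \<forall>l. cmod (coord E x $ l) < \<rho> \<Longrightarrow> i \<in> indices L \<Longrightarrow> x \<in> triv_dom L i \<Longrightarrow>
      ((\<lambda>\<alpha>. a \<alpha> * monomial (coord E x) \<alpha>) has_sum (s i x / frame E i x ^ k)) UNIV"
      using a(1) unfolding has_expansion_def by blast
    define f where "f z = s i (\<iota> z) * inverse (fr z ^ k)" for z
    have S: "pointwise_norm2 \<psi> k s i (\<iota> z) \<le> S" if "z \<in> P" for z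
      unfolding S_def using \<iota>[OF that] i(1)
      by (intro pointwise_norm2_le_sup_norm2[OF X L \<psi> s]) (auto simp: N_def)
    have S0: "0 \<le> S" by (rule order_trans[OF pointwise_norm2_nonneg S[OF P(2)]])
    have "cmod (a \<alpha>) * r ^ (\<Sum>l\<in>UNIV. \<alpha> $ l) \<le> sqrt (S * exp (real k * B))"
    proof (rule lex_lowest_coefficient_bound[OF _ r])
      have "holomorphic_fun X (s i) (triv_dom L i)" using s i unfolding H0_def by blast
      from holomorphic_fun_in_coordinates[OF X E this]
      have "holomorphic_cn (\<lambda>z. s i (\<iota> z)) P" by (simp add: \<iota>_def P_def N_def)
      moreover have "holomorphic_cn (\<lambda>z. inverse (fr z ^ k)) P"
        using fr0 by (intro holomorphic_cn_inverse holomorphic_cn_power fr_hol) auto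
      ultimately have "holomorphic_cn f P" unfolding f_def[abs_def] by (rule holomorphic_cn_mult)
      then show "holomorphic_cn f {z. \<forall>l. cmod (z $ l) < R}"
        by (rule holomorphic_cn_subset[OF _ order_trans[OF poly e(2)]])
    next
      fix z :: "complex ^ 'n::{finite,linorder}" assume z: "\<And>l. cmod (z $ l) \<le> r"
      then have "z \<in> {z. \<forall>l. cmod (z $ l) < R}" using r(2) le_less_trans by blast
      then have ze: "z \<in> cball 0 e" using poly by blast
      then have zP: "z \<in> P" using e by blast
      have fz: "0 < cmod (fr z)" using fr0[OF zP] by simp
      have "(cmod (f z))\<^sup>2 = (cmod (s i (\<iota> z)))\<^sup>2 * exp (- (real k * (2 * ln (cmod (fr z)))))"
      proof -
        have "exp (real k * (2 * ln (cmod (fr z)))) = ((cmod (fr z))\<^sup>2) ^ k"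
          using fz by (simp add: exp_of_nat_mult exp_double)
        then show ?thesis
          by (simp add: f_def norm_mult norm_inverse norm_power power_mult_distrib exp_minus power_inverse
              mult.commute flip: power_mult)
      qed
      also have "\<dots> = pointwise_norm2 \<psi> k s i (\<iota> z) * exp (real k * (\<psi> i (\<iota> z) - 2 * ln (cmod (fr z))))"
        by (simp add: pointwise_norm2_def right_diff_distrib mult.assoc flip: exp_add)
      also have "\<dots> \<le> S * exp (real k * B)"
        using S[OF zP] S0 B[OF ze] by (intro mult_mono) (auto intro!: mult_left_mono)
      finally show "cmod (f z) \<le> sqrt (S * exp (real k * B))"
        by (rule real_le_rsqrt)
    next
      show "0 < min \<rho> R" using \<rho> R by simp
      fix z :: "complex ^ 'n::{finite,linorder}" assume z: "\<And>l. cmod (z $ l) < min \<rho> R"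
      then have zP: "z \<in> P" using poly e by auto
      have "((\<lambda>\<alpha>. a \<alpha> * monomial (coord E (\<iota> z)) \<alpha>) has_sum (s i (\<iota> z) / frame E i (\<iota> z) ^ k)) UNIV"
        using \<iota>[OF zP] z i by (intro \<rho>(2)) (auto simp: N_def)
      then show "((\<lambda>\<beta>. a \<beta> * monomial z \<beta>) has_sum f z) UNIV"
        by (simp add: \<iota>(2)[OF zP] f_def fr_def divide_inverse)
    qed (rule a(3))
    then have "r ^ A \<le> sqrt (S * exp (real k * B))" by (simp add: a(2) A_def)
    then have "(r ^ A)\<^sup>2 \<le> (sqrt (S * exp (real k * B)))\<^sup>2"
      using r by (intro power_mono) auto
    then have le: "(r ^ A)\<^sup>2 \<le> S * exp (real k * B)" using S0 by simp
    moreover have rA: "0 < (r ^ A)\<^sup>2" using r by simp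
    ultimately have "0 < S * exp (real k * B)" by (rule less_le_trans[rotated])
    then have Spos: "0 < S" by (rule zero_less_mult_pos2) simp
    have "ln ((r ^ A)\<^sup>2) \<le> ln (S * exp (real k * B))"
      using le rA less_le_trans[OF rA le] by (subst ln_le_cancel_iff)
    then have "2 * real A * ln r \<le> ln S + real k * B"
      using Spos r by (simp add: ln_mult ln_realpow)
    moreover have "- (2 * \<bar>ln r\<bar>) * real A \<le> 2 * real A * ln r"
      using mult_left_mono[OF abs_ge_minus_self[of "ln r"], of "2 * real A"] by (simp add: mult_ac)
    moreover have "0 \<le> B * real A" "0 \<le> 2 * \<bar>ln r\<bar> * real k" using B0 by auto
    moreover have "- C * (real k + real A)
        = - (real k * B) - B * real A - 2 * \<bar>ln r\<bar> * real k + - (2 * \<bar>ln r\<bar>) * real A"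
      by (simp add: C_def algebra_simps)
    ultimately have "- C * (real k + real A) \<le> ln S" by linarith
    then show "0 < sup_norm2 L \<psi> k s \<and> - C * (real k + (\<Sum>l\<in>UNIV. real (\<alpha> $ l))) \<le> ln (sup_norm2 L \<psi> k s)"
      using Spos by (simp add: S_def A_def)
  qed
qed

section \<open>The Chebyshev transform\<close>

text \<open>The affine space \<open>A\<^sub>\<alpha>\<^sub>,\<^sub>k\<close>, indexed by the multi-index \<open>m = k\<alpha>\<close>.\<close>

definition unit_sections ::
  "('x::t2_space, 'n::{finite,linorder}) cspace \<Rightarrow> ('x, 'i) lbundle \<Rightarrow> ('x, 'n, 'i) local_data
     \<Rightarrow> nat \<Rightarrow> nat ^ 'n::{finite,linorder} \<Rightarrow> ('i \<Rightarrow> 'x \<Rightarrow> complex) set" where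
  "unit_sections X L E k m = {s \<in> H0 X L k. has_lowest_term L E k s 1 m}"

text \<open>Embedded in a Euclidean space, so that convexity and limits of slopes make sense.\<close>

definition valuation_semigroup ::
  "('x::t2_space, 'n::{finite,linorder}) cspace \<Rightarrow> ('x, 'i) lbundle \<Rightarrow> ('x, 'n, 'i) local_data
     \<Rightarrow> ((real ^ 'n::{finite,linorder}) \<times> real) set" where
  "valuation_semigroup X L E = {(real_vec m, real k) | m k. 1 \<le> k \<and> m \<in> valuation_set X L E k}"

text \<open>The floor recovers the level, which is a natural number on \<open>valuation_semigroup\<close>.\<close>

definition graded_functional ::
  "('x::t2_space, 'n::{finite,linorder}) cspace \<Rightarrow> ('x, 'i) lbundle \<Rightarrow> ('x, 'n, 'i) local_data
     \<Rightarrow> ('i \<Rightarrow> 'x \<Rightarrow> real) \<Rightarrow> (real ^ 'n::{finite,linorder}) \<times> real \<Rightarrow> real" where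
  "graded_functional X L E \<psi> v = F_functional X L E \<psi> (fst v) (nat \<lfloor>snd v\<rfloor>)"

lemma real_vec_inject: "real_vec m = real_vec m' \<longleftrightarrow> m = m'"
  by (simp add: real_vec_def vec_eq_iff)

lemma real_vec_add: "real_vec (m + m') = real_vec m + real_vec m'"
  by (simp add: real_vec_def vec_eq_iff)

lemma A_space_real_vec:
  assumes "1 \<le> k"
  shows "A_space X L E ((1 / real k) *\<^sub>R real_vec m) k = unit_sections X L E k m"
proof -
  have "real k *\<^sub>R (1 / real k) *\<^sub>R real_vec m = real_vec m" using assms by simp
  then show ?thesis
    unfolding A_space_def unit_sections_def by (auto simp: real_vec_inject)
qed

lemma graded_functional_eq:
  assumes "1 \<le> k"
  shows "graded_functional X L E \<psi> (real_vec m, real k) =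
    (INF s\<in>unit_sections X L E k m. ln (sup_norm2 L \<psi> k s))"
  by (simp only: graded_functional_def F_functional_def fst_conv snd_conv floor_of_nat nat_int
      A_space_real_vec[OF assms])

lemma unit_sections_nonempty:
  assumes "m \<in> valuation_set X L E k"
  shows "unit_sections X L E k m \<noteq> {}"
proof -
  obtain s c where s: "s \<in> H0 X L k" "c \<noteq> 0" "has_lowest_term L E k s c m"
    using assms unfolding valuation_set_def has_valuation_def by blast
  have "has_lowest_term L E k (section_scale (1 / c) s) 1 m"
    using has_lowest_term_scale[OF s(3), of "1 / c"] s(2) by simp
  then show ?thesis
    using H0_scale[OF s(1), of "1 / c"] unfolding unit_sections_def by blast
qed

lemma unit_sections_mult:
  assumes "s \<in> unit_sections X L E k m" "t \<in> unit_sections X L E k' m'"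
  shows "s * t \<in> unit_sections X L E (k + k') (m + m')"
  using assms H0_mult[of s X L k t k'] has_lowest_term_mult[of L E k s 1 m k' t 1 m']
  unfolding unit_sections_def by simp

lemma valuation_set_unit_sections:
  assumes "s \<in> unit_sections X L E k m" "s \<noteq> 0"
  shows "m \<in> valuation_set X L E k"
proof -
  have "has_valuation L E k s m"
    using assms unfolding unit_sections_def has_valuation_def by (intro exI[of _ 1]) simp
  then show ?thesis using assms unfolding unit_sections_def valuation_set_def by blast
qed

lemma slopes_valuation_semigroup:
  "(\<lambda>u. (1 / snd u) *\<^sub>R fst u) ` valuation_semigroup X L E = (\<Union>k\<in>{1..}. scaled_valuation_set X L E k)"
proof (intro equalityI subsetI)
  fix y assume "y \<in> (\<lambda>u. (1 / snd u) *\<^sub>R fst u) ` valuation_semigroup X L E"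
  then obtain m k where "y = (1 / real k) *\<^sub>R real_vec m" "1 \<le> k" "m \<in> valuation_set X L E k"
    unfolding valuation_semigroup_def by auto
  then show "y \<in> (\<Union>k\<in>{1..}. scaled_valuation_set X L E k)"
    unfolding scaled_valuation_set_def by blast
next
  fix y assume "y \<in> (\<Union>k\<in>{1..}. scaled_valuation_set X L E k)"
  then obtain m k where *: "y = (1 / real k) *\<^sub>R real_vec m" "1 \<le> k" "m \<in> valuation_set X L E k"
    unfolding scaled_valuation_set_def by auto
  then have "(real_vec m, real k) \<in> valuation_semigroup X L E"
    unfolding valuation_semigroup_def by blast
  then show "y \<in> (\<lambda>u. (1 / snd u) *\<^sub>R fst u) ` valuation_semigroup X L E"
    by (rule image_eqI[rotated]) (simp add: *)
qed

theorem theorem1p2: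
  fixes X :: "('x::t2_space, 'n::{finite,linorder}) cspace"
    and L :: "('x, 'i) lbundle"
    and \<psi> :: "'i \<Rightarrow> 'x \<Rightarrow> real"
    and x0 :: 'x
    and E :: "('x, 'n, 'i) local_data"
    and p :: "real ^ 'n::{finite,linorder}"
  assumes "projective_manifold X"
    and "line_bundle X L"
    and "big X L"
    and "continuous_metric L \<psi>"
    and "x0 \<in> points X"
    and "local_data_at X L x0 E"
    and "p \<in> interior (okounkov_body X L E)"
  shows "\<exists>c::real. \<forall>\<alpha>::nat \<Rightarrow> real ^ 'n::{finite,linorder}.
           (\<forall>\<^sub>F k in sequentially. \<alpha> k \<in> scaled_valuation_set X L E k) \<longrightarrow> \<alpha> \<longlonglongrightarrow> p \<longrightarrow>
           (\<lambda>k. (1 / real k) * F_functional X L E \<psi> (real k *\<^sub>R \<alpha> k) k) \<longlonglongrightarrow> c"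
proof -
  have X: "compact_complex_manifold X" using assms(1) unfolding projective_manifold_def by blast
  obtain C where C: "0 \<le> C"
    "\<And>k s \<alpha>. s \<in> H0 X L k \<Longrightarrow> has_lowest_term L E k s 1 \<alpha> \<Longrightarrow>
       0 < sup_norm2 L \<psi> k s \<and> - C * (real k + (\<Sum>l\<in>UNIV. real (\<alpha> $ l))) \<le> ln (sup_norm2 L \<psi> k s)"
    using ln_sup_norm2_lower_bound[OF X assms(2,4,5,6)] by blast
  let ?\<Gamma> = "valuation_semigroup X L E"
  let ?F = "graded_functional X L E \<psi>"
  have ln_lower: "- C * (real k + (\<Sum>l\<in>UNIV. real (m $ l))) \<le> ln (sup_norm2 L \<psi> k s)"
    and pos: "0 < sup_norm2 L \<psi> k s" if "s \<in> unit_sections X L E k m" for s k m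
    using C(2)[of s k m] that unfolding unit_sections_def by blast+
  have bdd: "bdd_below ((\<lambda>s. ln (sup_norm2 L \<psi> k s)) ` unit_sections X L E k m)" for k m
    using ln_lower by (rule bdd_belowI2)
  \<comment> \<open>The zero section has norm \<open>0\<close>, which the lower bound excludes.\<close>
  have nonzero: "s \<noteq> 0" if s: "s \<in> unit_sections X L E k m" for s k m
  proof
    assume "s = 0"
    obtain i where "i \<in> indices L" "x0 \<in> triv_dom L i"
      using assms(2,5) unfolding line_bundle_def by blast
    then have "{(cmod (s i x))\<^sup>2 * exp (- (real k * \<psi> i x)) | i x. i \<in> indices L \<and> x \<in> triv_dom L i} = {0}"
      unfolding \<open>s = 0\<close> by auto
    then show False using pos[OF s] by (simp add: sup_norm2_def)
  qed
  interpret subadditive_semigroup ?\<Gamma> ?F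
  proof
    fix u v assume "u \<in> ?\<Gamma>" "v \<in> ?\<Gamma>"
    then obtain m k m' k' where u: "u = (real_vec m, real k)" "1 \<le> k" "m \<in> valuation_set X L E k"
      and v: "v = (real_vec m', real k')" "1 \<le> k'" "m' \<in> valuation_set X L E k'"
      unfolding valuation_semigroup_def by blast
    have uv: "u + v = (real_vec (m + m'), real (k + k'))" by (simp add: u v real_vec_add)
    have kk: "1 \<le> k + k'" using u(2) by simp
    obtain s t where s: "s \<in> unit_sections X L E k m" and t: "t \<in> unit_sections X L E k' m'"
      using unit_sections_nonempty u(3) v(3) by blast
    have "s * t \<in> unit_sections X L E (k + k') (m + m')" by (rule unit_sections_mult[OF s t])
    then have "m + m' \<in> valuation_set X L E (k + k')"
      using nonzero valuation_set_unit_sections by blast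
    then show "u + v \<in> ?\<Gamma>"
      unfolding uv valuation_semigroup_def using kk by blast
    show "?F (u + v) \<le> ?F u + ?F v"
    proof -
      let ?I = "?F (u + v)"
      have Fu: "?F u = (INF s\<in>unit_sections X L E k m. ln (sup_norm2 L \<psi> k s))"
        and Fv: "?F v = (INF s\<in>unit_sections X L E k' m'. ln (sup_norm2 L \<psi> k' s))"
        unfolding u(1) v(1) by (rule graded_functional_eq[OF u(2)], rule graded_functional_eq[OF v(2)])
      have le: "?I \<le> ln (sup_norm2 L \<psi> k s) + ln (sup_norm2 L \<psi> k' t)"
        if s: "s \<in> unit_sections X L E k m" and t: "t \<in> unit_sections X L E k' m'" for s t
      proof -
        have st: "s * t \<in> unit_sections X L E (k + k') (m + m')" by (rule unit_sections_mult[OF s t])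
        have "?I \<le> ln (sup_norm2 L \<psi> (k + k') (s * t))"
          unfolding uv graded_functional_eq[OF kk] by (rule cINF_lower[OF bdd st])
        also have "\<dots> \<le> ln (sup_norm2 L \<psi> k s * sup_norm2 L \<psi> k' t)"
        proof (rule ln_mono)
          show "0 < sup_norm2 L \<psi> (k + k') (s * t)" using pos[OF st] .
          show "sup_norm2 L \<psi> (k + k') (s * t) \<le> sup_norm2 L \<psi> k s * sup_norm2 L \<psi> k' t"
            using s t assms(5) unfolding unit_sections_def
            by (intro sup_norm2_mult[OF X assms(2,4)]) auto
        qed
        also have "\<dots> = ln (sup_norm2 L \<psi> k s) + ln (sup_norm2 L \<psi> k' t)"
          using pos[OF s] pos[OF t] by (rule ln_mult_pos)
        finally show ?thesis .
      qed
      have "?I - ?F v \<le> ln (sup_norm2 L \<psi> k s)" if s': "s \<in> unit_sections X L E k m" for s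
      proof -
        have "?I - ln (sup_norm2 L \<psi> k s) \<le> ?F v"
          unfolding Fv
        proof (rule cINF_greatest)
          fix t assume "t \<in> unit_sections X L E k' m'"
          from le[OF s' this] show "?I - ln (sup_norm2 L \<psi> k s) \<le> ln (sup_norm2 L \<psi> k' t)" by simp
        qed (rule unit_sections_nonempty[OF v(3)])
        then show ?thesis by simp
      qed
      then have "?I - ?F v \<le> ?F u"
        unfolding Fu by (rule cINF_greatest[OF unit_sections_nonempty[OF u(3)]])
      then show ?thesis by simp
    qed
  next
    fix u and b :: "(real ^ 'n::{finite,linorder}) \<times> real" assume "u \<in> ?\<Gamma>" "b \<in> Basis"
    then show "u \<bullet> b \<in> \<int>"
      unfolding valuation_semigroup_def
      by (auto simp: Basis_prod_def Basis_vec_def real_vec_def inner_axis)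
  next
    fix u assume "u \<in> ?\<Gamma>"
    then show "1 \<le> snd u" unfolding valuation_semigroup_def by auto
  qed
  have slope: "p \<in> interior (closure (convex hull slopes))"
    using assms(7) unfolding okounkov_body_def slopes_def slopes_valuation_semigroup .
  have lower: "- (C * (1 + real CARD('n::{finite,linorder}))) * norm u \<le> ?F u" if uG: "u \<in> ?\<Gamma>" for u
  proof -
    obtain m k where u: "u = (real_vec m, real k)" "1 \<le> k" "m \<in> valuation_set X L E k"
      using uG unfolding valuation_semigroup_def by blast
    have k: "real k \<le> norm u" using norm_snd_le[where x = "real_vec m" and y = "real k"] by (simp add: u)
    have m: "real (m $ l) \<le> norm u" for l
    proof -
      have "real (m $ l) \<le> norm (real_vec m)"
        using component_le_norm_cart[of "real_vec m" l] by (simp add: real_vec_def)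
      also have "\<dots> \<le> norm u" using norm_fst_le[where x = "real_vec m" and y = "real k"] by (simp only: u)
      finally show ?thesis .
    qed
    have "real k + (\<Sum>l\<in>UNIV. real (m $ l)) \<le> norm u + (\<Sum>l\<in>(UNIV::'n::{finite,linorder} set). norm u)"
      using k m by (intro add_mono sum_mono)
    also have "\<dots> = (1 + real CARD('n::{finite,linorder})) * norm u" by (simp add: algebra_simps)
    finally have "C * (real k + (\<Sum>l\<in>UNIV. real (m $ l))) \<le> C * ((1 + real CARD('n::{finite,linorder})) * norm u)"
      using C(1) by (rule mult_left_mono)
    then have "- (C * (1 + real CARD('n::{finite,linorder}))) * norm u \<le> - C * (real k + (\<Sum>l\<in>UNIV. real (m $ l)))"
      by (simp add: mult.assoc)
    also have "\<dots> \<le> ?F u"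
      unfolding u(1) graded_functional_eq[OF u(2)]
      by (rule cINF_greatest[OF unit_sections_nonempty[OF u(3)] ln_lower])
    finally show ?thesis .
  qed
  obtain c where c: "\<forall>a. (\<forall>\<^sub>F k in sequentially. a k \<in> ?\<Gamma>) \<longrightarrow>
      filterlim (\<lambda>k. snd (a k)) at_top sequentially \<longrightarrow>
      (\<lambda>k. (1 / snd (a k)) *\<^sub>R fst (a k)) \<longlonglongrightarrow> p \<longrightarrow> (\<lambda>k. ?F (a k) / snd (a k)) \<longlonglongrightarrow> c"
    using normalized_limit_exists[OF slope lower] by (rule exE)
  show ?thesis
  proof (rule exI[of _ c], intro allI impI)
    fix \<alpha> :: "nat \<Rightarrow> real ^ 'n::{finite,linorder}"
    assume \<alpha>: "\<forall>\<^sub>F k in sequentially. \<alpha> k \<in> scaled_valuation_set X L E k" "\<alpha> \<longlonglongrightarrow> p"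
    define a where "a k = (real k *\<^sub>R \<alpha> k, real k)" for k
    have "(\<lambda>k. ?F (a k) / snd (a k)) \<longlonglongrightarrow> c"
    proof (rule c[rule_format])
      show "\<forall>\<^sub>F k in sequentially. a k \<in> ?\<Gamma>"
        using \<alpha>(1) eventually_ge_at_top[of 1]
      proof eventually_elim
        case (elim k)
        then obtain m where m: "\<alpha> k = (1 / real k) *\<^sub>R real_vec m" "m \<in> valuation_set X L E k"
          unfolding scaled_valuation_set_def by blast
        then have "a k = (real_vec m, real k)" using elim by (simp add: a_def)
        then show ?case unfolding valuation_semigroup_def using elim m(2) by blast
      qed
      show "filterlim (\<lambda>k. snd (a k)) at_top sequentially"
        by (simp add: a_def filterlim_real_sequentially)
      have "\<forall>\<^sub>F k in sequentially. (1 / snd (a k)) *\<^sub>R fst (a k) = \<alpha> k"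
        using eventually_ge_at_top[of 1] by eventually_elim (simp add: a_def)
      then show "(\<lambda>k. (1 / snd (a k)) *\<^sub>R fst (a k)) \<longlonglongrightarrow> p"
        using \<alpha>(2) by (simp add: tendsto_cong)
    qed
    then show "(\<lambda>k. (1 / real k) * F_functional X L E \<psi> (real k *\<^sub>R \<alpha> k) k) \<longlonglongrightarrow> c"
      by (simp add: a_def graded_functional_def)
  qed
qed

end
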